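(* Let $M$ be a smooth manifold, $n\ge1$, and let $\omega\in\Omega^{n+1}(M)$ be an $(n+1)$-form. Then the graph $\mathfrak{G}_\omega$ of $\omega_\sharp$ is a maximal isotropic subbundle of $\mathcal{T}^n=TM\oplus\wedge^nT^*M$. Furthermore, $\mathfrak{G}_\omega$ is closed under the higher-order Dorfman bracket $\{\cdot,\cdot\}$ if and only if $\omega$ is closed, i.e. $d\omega=0$.
   Context: The bundle map $\omega_\sharp:TM\to\wedge^nT^*M$ is $\omega_\sharp(X)=i_X\omega$, and its graph is $\mathfrak{G}_\omega=\{X+i_X\omega:X\in TM\}\subset\mathcal{T}^n$. The $\wedge^{n-1}T^*M$-valued symmetric pairing on $\mathcal{T}^n$ is $(X+\alpha,Y+\beta)=\frac12(i_X\beta+i_Y\alpha)$. A subbundle is isotropic if the pairing vanishes identically on it, and maximal isotropic if it is not properly contained in another isotropic subbundle. The higher-order Dorfman bracket on $\Gamma(\mathcal{T}^n)$ is $$\{X+\alpha,Y+\beta\}=[X,Y]+L_X\beta-L_Y\alpha+d\,i_Y\alpha$$ for vector fields $X,Y$ and $\alpha,\beta\in\Omega^n(M)$. "Closed under the bracket" means that the bracket of two sections of $\mathfrak{G}_\omega$ is a section of $\mathfrak{G}_\omega$. *)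

theory Defs
  imports "HOL-Analysis.Analysis" "HOL-Library.Function_Algebras"
begin

text \<open>
  The real vector space structure on function types is pointwise.  It makes \<^const>\<open>span\<close>,
  \<^const>\<open>independent\<close> and the product vector space structure available for the fibres of the
  bundles below.
\<close>

instantiation "fun" :: (type, real_vector) real_vector
begin

definition scaleR_fun :: "real \<Rightarrow> ('a \<Rightarrow> 'b) \<Rightarrow> 'a \<Rightarrow> 'b" where
  "scaleR_fun a f = (\<lambda>x. a *\<^sub>R f x)"

instance
  by standard (simp_all add: scaleR_fun_def fun_eq_iff scaleR_add_right scaleR_add_left)

end

section \<open>Smooth manifolds\<close>

text \<open>
  On open subsets of a finite-dimensional space, \<open>C_diff k\<close> is the usual class of \<open>k\<close> times
  continuously differentiable maps: the total derivative is \<open>k\<close> times continuously differentiable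
  iff all its values on fixed vectors are.
\<close>

primrec C_diff :: "nat \<Rightarrow> 'a::real_normed_vector set \<Rightarrow> ('a \<Rightarrow> 'b::real_normed_vector) \<Rightarrow> bool" where
  "C_diff 0 S f \<longleftrightarrow> continuous_on S f"
| "C_diff (Suc k) S f \<longleftrightarrow> (\<forall>x\<in>S. f differentiable (at x)) \<and>
     (\<forall>v. C_diff k S (\<lambda>x. frechet_derivative f (at x) v))"

definition smooth_on :: "'a::real_normed_vector set \<Rightarrow> ('a \<Rightarrow> 'b::real_normed_vector) \<Rightarrow> bool" where
  "smooth_on S f \<longleftrightarrow> (\<forall>k. C_diff k S f)"

text \<open>A chart is given by its domain and its coordinate map, which is irrelevant off the domain.\<close>

type_synonym ('m, 'e) chart = "'m set \<times> ('m \<Rightarrow> 'e)"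

abbreviation dom_of :: "('m, 'e) chart \<Rightarrow> 'm set" where
  "dom_of c \<equiv> fst c"

abbreviation img_of :: "('m, 'e) chart \<Rightarrow> 'e set" where
  "img_of c \<equiv> snd c ` fst c"

abbreviation inv_of :: "('m, 'e) chart \<Rightarrow> 'e \<Rightarrow> 'm" where
  "inv_of c \<equiv> inv_into (fst c) (snd c)"

text \<open>
  The manifold is the whole type \<open>'m\<close>; the model space \<open>'e\<close> is any finite-dimensional inner product
  space.  (The class \<^class>\<open>euclidean_space\<close> would exclude manifolds of dimension \<open>0\<close>.)
\<close>

definition smooth_manifold ::
    "('m::{t2_space, second_countable_topology}, 'e::real_inner) chart set \<Rightarrow> bool" where
  "smooth_manifold A \<longleftrightarrow>
     (\<exists>B::'e set. finite B \<and> span B = UNIV) \<and>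
     (\<Union>c\<in>A. dom_of c) = UNIV \<and>
     (\<forall>c\<in>A. open (dom_of c) \<and> open (img_of c) \<and>
        homeomorphism (dom_of c) (img_of c) (snd c) (inv_of c)) \<and>
     (\<forall>c\<in>A. \<forall>c'\<in>A. smooth_on (snd c ` (dom_of c \<inter> dom_of c')) (snd c' \<circ> inv_of c))"

section \<open>Tangent vectors and vector fields\<close>

text \<open>
  A tangent vector at \<open>p\<close> assigns to each chart around \<open>p\<close> its coordinate vector in that chart; the
  coordinate vectors are related by the Jacobians of the transition maps.  The value \<open>0\<close> at charts
  that are not around \<open>p\<close> is a normalisation, so that equality of tangent vectors is equality of
  functions.
\<close>

type_synonym ('m, 'e) tvec = "('m, 'e) chart \<Rightarrow> 'e"

definition tangent_space ::
    "('m::topological_space, 'e::real_normed_vector) chart set \<Rightarrow> 'm \<Rightarrow> ('m, 'e) tvec set" where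
  "tangent_space A p =
     {v. (\<forall>c. \<not> (c \<in> A \<and> p \<in> dom_of c) \<longrightarrow> v c = 0) \<and>
         (\<forall>c\<in>A. \<forall>c'\<in>A. p \<in> dom_of c \<inter> dom_of c' \<longrightarrow>
            v c' = frechet_derivative (snd c' \<circ> inv_of c) (at (snd c p)) (v c))}"

text \<open>The tangent vector at \<open>p\<close> with coordinate vector \<open>e\<close> in the chart \<open>c\<close>.\<close>

definition coord_tvec ::
    "('m::topological_space, 'e::real_normed_vector) chart set \<Rightarrow> ('m, 'e) chart \<Rightarrow> 'm \<Rightarrow> 'e \<Rightarrow>
     ('m, 'e) tvec" where
  "coord_tvec A c p e =
     (\<lambda>c'. if c' \<in> A \<and> p \<in> dom_of c'
           then frechet_derivative (snd c' \<circ> inv_of c) (at (snd c p)) e else 0)"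

text \<open>
  Some chart around \<open>p\<close>.  The operations below that are defined by a formula in this chart are given
  by the same formula in every other chart around \<open>p\<close>.
\<close>

definition chart_at :: "('m, 'e) chart set \<Rightarrow> 'm \<Rightarrow> ('m, 'e) chart" where
  "chart_at A p = (SOME c. c \<in> A \<and> p \<in> dom_of c)"

definition field_rep :: "('m, 'e) chart \<Rightarrow> ('m \<Rightarrow> ('m, 'e) tvec) \<Rightarrow> 'e \<Rightarrow> 'e" where
  "field_rep c X x = X (inv_of c x) c"

definition smooth_field_on ::
    "('m::topological_space, 'e::real_normed_vector) chart set \<Rightarrow> 'm set \<Rightarrow>
     ('m \<Rightarrow> ('m, 'e) tvec) \<Rightarrow> bool" where
  "smooth_field_on A U X \<longleftrightarrow>
     (\<forall>p\<in>U. X p \<in> tangent_space A p) \<and>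
     (\<forall>c\<in>A. smooth_on (snd c ` (dom_of c \<inter> U)) (field_rep c X))"

text \<open>In coordinates \<open>[X, Y]\<^sup>j = X\<^sup>i \<partial>\<^sub>i Y\<^sup>j - Y\<^sup>i \<partial>\<^sub>i X\<^sup>j\<close>.\<close>

definition lie_bracket ::
    "('m::topological_space, 'e::real_normed_vector) chart set \<Rightarrow>
     ('m \<Rightarrow> ('m, 'e) tvec) \<Rightarrow> ('m \<Rightarrow> ('m, 'e) tvec) \<Rightarrow> 'm \<Rightarrow> ('m, 'e) tvec" where
  "lie_bracket A X Y p =
     (let c = chart_at A p in
      coord_tvec A c p
        (frechet_derivative (field_rep c Y) (at (snd c p)) (X p c) -
         frechet_derivative (field_rep c X) (at (snd c p)) (Y p c)))"

section \<open>Differential forms\<close>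

text \<open>
  An alternating \<open>k\<close>-linear form takes the list of its \<open>k\<close> arguments.  The value \<open>0\<close> outside of the
  lists of \<open>k\<close> tangent vectors is a normalisation.
\<close>

type_synonym ('m, 'e) cov = "('m, 'e) tvec list \<Rightarrow> real"

definition alt_forms ::
    "('m::topological_space, 'e::real_normed_vector) chart set \<Rightarrow> nat \<Rightarrow> 'm \<Rightarrow> ('m, 'e) cov set" where
  "alt_forms A k p =
     {\<alpha>. (\<forall>vs. \<not> (length vs = k \<and> set vs \<subseteq> tangent_space A p) \<longrightarrow> \<alpha> vs = 0) \<and>
         (\<forall>us ws. length us + 1 + length ws = k \<longrightarrow> set us \<union> set ws \<subseteq> tangent_space A p \<longrightarrow>
            (\<forall>v\<in>tangent_space A p. \<forall>w\<in>tangent_space A p.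
               \<alpha> (us @ (v + w) # ws) = \<alpha> (us @ v # ws) + \<alpha> (us @ w # ws)) \<and>
            (\<forall>a. \<forall>v\<in>tangent_space A p. \<alpha> (us @ (a *\<^sub>R v) # ws) = a * \<alpha> (us @ v # ws))) \<and>
         (\<forall>vs. \<not> distinct vs \<longrightarrow> \<alpha> vs = 0)}"

definition form_rep ::
    "('m::topological_space, 'e::real_normed_vector) chart set \<Rightarrow> ('m, 'e) chart \<Rightarrow>
     ('m \<Rightarrow> ('m, 'e) cov) \<Rightarrow> 'e \<Rightarrow> 'e list \<Rightarrow> real" where
  "form_rep A c \<eta> x es = \<eta> (inv_of c x) (map (coord_tvec A c (inv_of c x)) es)"

definition smooth_form_on ::
    "('m::topological_space, 'e::real_normed_vector) chart set \<Rightarrow> nat \<Rightarrow> 'm set \<Rightarrow>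
     ('m \<Rightarrow> ('m, 'e) cov) \<Rightarrow> bool" where
  "smooth_form_on A k U \<eta> \<longleftrightarrow>
     (\<forall>p\<in>U. \<eta> p \<in> alt_forms A k p) \<and>
     (\<forall>c\<in>A. \<forall>es. smooth_on (snd c ` (dom_of c \<inter> U)) (\<lambda>x. form_rep A c \<eta> x es))"

definition contract :: "('m, 'e) tvec \<Rightarrow> ('m, 'e) cov \<Rightarrow> ('m, 'e) cov" where
  "contract v \<alpha> = (\<lambda>vs. \<alpha> (v # vs))"

text \<open>
  In coordinates \<open>d\<eta> = (\<partial>\<^sub>j \<eta>\<^sub>I) dx\<^sup>j \<and> dx\<^sup>I\<close>, that is,
  \<open>d\<eta>(v\<^sub>0, \<dots>, v\<^sub>k) = (\<Sum>i\<le>k. (- 1)^i (\<partial>\<^bsub>v\<^sub>i\<^esub> \<eta>)(v\<^sub>0, \<dots>, v\<^sub>i omitted, \<dots>, v\<^sub>k))\<close>.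
\<close>

definition ext_deriv ::
    "('m::topological_space, 'e::real_normed_vector) chart set \<Rightarrow> ('m \<Rightarrow> ('m, 'e) cov) \<Rightarrow>
     'm \<Rightarrow> ('m, 'e) cov" where
  "ext_deriv A \<eta> p vs =
     (if set vs \<subseteq> tangent_space A p then
        (let c = chart_at A p; es = map (\<lambda>v. v c) vs in
         \<Sum>i<length es. (- 1) ^ i *
           frechet_derivative (\<lambda>x. form_rep A c \<eta> x (take i es @ drop (Suc i) es))
             (at (snd c p)) (es ! i))
      else 0)"

text \<open>
  In coordinates \<open>(L\<^sub>X \<eta>)(v\<^sub>1, \<dots>, v\<^sub>k) = (\<partial>\<^sub>X \<eta>)(v\<^sub>1, \<dots>, v\<^sub>k) +
  (\<Sum>i. \<eta>(v\<^sub>1, \<dots>, \<partial>\<^bsub>v\<^sub>i\<^esub> X, \<dots>, v\<^sub>k))\<close>, the derivative at \<open>t = 0\<close> of the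
  pullback of \<open>\<eta>\<close> by the flow of \<open>X\<close>.
\<close>

definition lie_deriv ::
    "('m::topological_space, 'e::real_normed_vector) chart set \<Rightarrow> ('m \<Rightarrow> ('m, 'e) tvec) \<Rightarrow>
     ('m \<Rightarrow> ('m, 'e) cov) \<Rightarrow> 'm \<Rightarrow> ('m, 'e) cov" where
  "lie_deriv A X \<eta> p vs =
     (if set vs \<subseteq> tangent_space A p then
        (let c = chart_at A p; es = map (\<lambda>v. v c) vs in
         frechet_derivative (\<lambda>x. form_rep A c \<eta> x es) (at (snd c p)) (X p c) +
         (\<Sum>i<length es. form_rep A c \<eta> (snd c p)
            (es[i := frechet_derivative (field_rep c X) (at (snd c p)) (es ! i)])))
      else 0)"

definition closed_form ::
    "('m::topological_space, 'e::real_normed_vector) chart set \<Rightarrow> ('m \<Rightarrow> ('m, 'e) cov) \<Rightarrow> bool" where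
  "closed_form A \<eta> \<longleftrightarrow> (\<forall>p. ext_deriv A \<eta> p = 0)"

section \<open>The bundle \<open>TM \<oplus> \<Lambda>\<^sup>n T*M\<close>\<close>

text \<open>Bundles are represented by their families of fibres; \<open>X + \<alpha>\<close> is the pair \<open>(X, \<alpha>)\<close>.\<close>

type_synonym ('m, 'e) gvec = "('m, 'e) tvec \<times> ('m, 'e) cov"

definition smooth_section_on ::
    "('m::topological_space, 'e::real_normed_vector) chart set \<Rightarrow> nat \<Rightarrow> 'm set \<Rightarrow>
     ('m \<Rightarrow> ('m, 'e) gvec) \<Rightarrow> bool" where
  "smooth_section_on A n U s \<longleftrightarrow>
     smooth_field_on A U (fst \<circ> s) \<and> smooth_form_on A n U (snd \<circ> s)"

text \<open>A smooth subbundle is a family of subspaces of the fibres with smooth local frames.\<close>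

definition smooth_subbundle ::
    "('m::topological_space, 'e::real_normed_vector) chart set \<Rightarrow> nat \<Rightarrow>
     ('m \<Rightarrow> ('m, 'e) gvec set) \<Rightarrow> bool" where
  "smooth_subbundle A n G \<longleftrightarrow>
     (\<forall>p. subspace (G p) \<and> G p \<subseteq> tangent_space A p \<times> alt_forms A n p) \<and>
     (\<forall>p. \<exists>U r (s :: nat \<Rightarrow> 'm \<Rightarrow> ('m, 'e) gvec).
        open U \<and> p \<in> U \<and> (\<forall>i<r. smooth_section_on A n U (s i)) \<and>
        (\<forall>q\<in>U. inj_on (\<lambda>i. s i q) {..<r} \<and>
           independent ((\<lambda>i. s i q) ` {..<r}) \<and> span ((\<lambda>i. s i q) ` {..<r}) = G q))"

definition pairing :: "('m, 'e) gvec \<Rightarrow> ('m, 'e) gvec \<Rightarrow> ('m, 'e) cov" where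
  "pairing \<xi> \<zeta> = (1 / 2) *\<^sub>R (contract (fst \<xi>) (snd \<zeta>) + contract (fst \<zeta>) (snd \<xi>))"

definition isotropic_subbundle ::
    "('m::topological_space, 'e::real_normed_vector) chart set \<Rightarrow> nat \<Rightarrow>
     ('m \<Rightarrow> ('m, 'e) gvec set) \<Rightarrow> bool" where
  "isotropic_subbundle A n G \<longleftrightarrow>
     smooth_subbundle A n G \<and> (\<forall>p. \<forall>\<xi>\<in>G p. \<forall>\<zeta>\<in>G p. pairing \<xi> \<zeta> = 0)"

definition maximal_isotropic_subbundle ::
    "('m::topological_space, 'e::real_normed_vector) chart set \<Rightarrow> nat \<Rightarrow>
     ('m \<Rightarrow> ('m, 'e) gvec set) \<Rightarrow> bool" where
  "maximal_isotropic_subbundle A n G \<longleftrightarrow>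
     isotropic_subbundle A n G \<and>
     \<not> (\<exists>H. isotropic_subbundle A n H \<and> (\<forall>p. G p \<subseteq> H p) \<and> H \<noteq> G)"

definition sharp_graph ::
    "('m::topological_space, 'e::real_normed_vector) chart set \<Rightarrow> ('m \<Rightarrow> ('m, 'e) cov) \<Rightarrow>
     'm \<Rightarrow> ('m, 'e) gvec set" where
  "sharp_graph A \<omega> p = {(X, contract X (\<omega> p)) | X. X \<in> tangent_space A p}"

definition dorfman_bracket ::
    "('m::topological_space, 'e::real_normed_vector) chart set \<Rightarrow>
     ('m \<Rightarrow> ('m, 'e) gvec) \<Rightarrow> ('m \<Rightarrow> ('m, 'e) gvec) \<Rightarrow> 'm \<Rightarrow> ('m, 'e) gvec" where
  "dorfman_bracket A s t p =
     (let X = fst \<circ> s; \<alpha> = snd \<circ> s; Y = fst \<circ> t; \<beta> = snd \<circ> t in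
      (lie_bracket A X Y p,
       lie_deriv A X \<beta> p - lie_deriv A Y \<alpha> p +
         ext_deriv A (\<lambda>q. contract (Y q) (\<alpha> q)) p))"

definition sections_of ::
    "('m::topological_space, 'e::real_normed_vector) chart set \<Rightarrow> nat \<Rightarrow>
     ('m \<Rightarrow> ('m, 'e) gvec set) \<Rightarrow> ('m \<Rightarrow> ('m, 'e) gvec) set" where
  "sections_of A n G = {s. smooth_section_on A n UNIV s \<and> (\<forall>p. s p \<in> G p)}"

definition closed_under_dorfman ::
    "('m::topological_space, 'e::real_normed_vector) chart set \<Rightarrow> nat \<Rightarrow>
     ('m \<Rightarrow> ('m, 'e) gvec set) \<Rightarrow> bool" where
  "closed_under_dorfman A n G \<longleftrightarrow>
     (\<forall>s\<in>sections_of A n G. \<forall>t\<in>sections_of A n G. dorfman_bracket A s t \<in> sections_of A n G)"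

end

theory Submission
  imports Defs
begin

text \<open>
  In a chart, the product rule gives \<open>L\<^sub>X i\<^sub>Y \<omega> - L\<^sub>Y i\<^sub>X \<omega> + d i\<^sub>Y i\<^sub>X \<omega> = i\<^bsub>[X,Y]\<^esub> \<omega> + i\<^sub>Y i\<^sub>X d\<omega>\<close>,
  so the bracket of the sections \<open>X + i\<^sub>X \<omega>\<close> and \<open>Y + i\<^sub>Y \<omega>\<close> lies in the graph iff
  \<open>i\<^sub>Y i\<^sub>X d\<omega> = 0\<close>.  Every tangent vector extends to a global field by a bump function, so this
  holds for all sections iff \<open>d\<omega> = 0\<close>.  That the bracket is a smooth section rests on the chart
  independence of \<open>[X, Y]\<close>, that is, on the symmetry of the second derivatives of the transition
  maps.  For maximality, an element of a larger isotropic bundle differs from one of the graph by some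
  \<open>0 + \<gamma>\<close>, and pairing with the graph gives \<open>i\<^sub>X \<gamma> = 0\<close> for all \<open>X\<close>, hence \<open>\<gamma> = 0\<close> as \<open>n \<ge> 1\<close>.
\<close>

section \<open>Calculus of smooth maps\<close>

text \<open>\<open>frechet_derivative\<close> chooses some derivative, so it suffices that
  \<open>f\<close> and \<open>g\<close> have the same derivatives at \<open>x\<close>;
  differentiability does not enter.\<close>

lemma frechet_derivative_cong_open:
  assumes "open S" "x \<in> S" "\<And>y. y \<in> S \<Longrightarrow> f y = g y"
  shows "frechet_derivative f (at x) = frechet_derivative g (at x)"
proof -
  have "(f has_derivative D) (at x) = (g has_derivative D) (at x)" for D
    using assms by (metis has_derivative_transform_within_open)
  then show ?thesis
    by (simp add: frechet_derivative_def)
qed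

lemma has_derivative_frechet:
  "f differentiable at x \<Longrightarrow> (f has_derivative frechet_derivative f (at x)) (at x)"
  by (simp add: frechet_derivative_works)

lemma C_diff_cong:
  assumes "open S" "\<And>x. x \<in> S \<Longrightarrow> f x = g x" "C_diff k S f"
  shows "C_diff k S g"
  using assms(2,3)
proof (induction k arbitrary: f g)
  case 0
  then show ?case by (simp cong: continuous_on_cong)
next
  case (Suc k)
  have "(g has_derivative frechet_derivative f (at x)) (at x)" if "x \<in> S" for x
    using has_derivative_transform_within_open[OF has_derivative_frechet assms(1) that Suc.prems(1)]
      Suc.prems(2) that by simp
  then have "g differentiable at x" if "x \<in> S" for x
    using that by (auto simp: differentiable_def)
  moreover have "C_diff k S (\<lambda>x. frechet_derivative g (at x) v)" for v
  proof (rule Suc.IH)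
    show "frechet_derivative f (at x) v = frechet_derivative g (at x) v" if "x \<in> S" for x
      by (simp add: frechet_derivative_cong_open[OF assms(1) that Suc.prems(1)])
  qed (use Suc.prems in simp)
  ultimately show ?case by simp
qed

lemma C_diff_subset: "C_diff k S f \<Longrightarrow> T \<subseteq> S \<Longrightarrow> C_diff k T f"
  by (induction k arbitrary: f) (auto intro: continuous_on_subset)

lemma C_diff_Suc_imp: "C_diff (Suc k) S f \<Longrightarrow> C_diff k S f"
proof (induction k arbitrary: f)
  case 0
  then show ?case
    by (auto intro!: continuous_at_imp_continuous_on differentiable_imp_continuous_within)
qed simp

text \<open>Allows the derivative to be supplied by any formula \<open>f'\<close> in place of the
  chosen \<open>frechet_derivative\<close>. The inductions for sums, products and compositions go
  through it.\<close>

lemma C_diff_SucI: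
  assumes "\<And>x. x \<in> S \<Longrightarrow> (f has_derivative f' x) (at x)" "open S"
    and "\<And>v. C_diff k S (\<lambda>x. f' x v)"
  shows "C_diff (Suc k) S f"
proof -
  have "C_diff k S (\<lambda>x. frechet_derivative f (at x) v)" for v
    by (rule C_diff_cong[OF assms(2) _ assms(3)]) (simp add: frechet_derivative_at[OF assms(1), symmetric])
  with assms show ?thesis by (auto simp: differentiable_def)
qed

text \<open>Differentiability at a point does not refer to the set, so openness matters only for
  continuity at order 0. It serves to glue local descriptions of one map.\<close>

lemma C_diff_Union:
  assumes "\<And>T. T \<in> \<T> \<Longrightarrow> open T" "\<And>T. T \<in> \<T> \<Longrightarrow> C_diff k T f"
  shows "C_diff k (\<Union>\<T>) f"
  using assms(2)
proof (induction k arbitrary: f)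
  case 0
  then show ?case using assms(1) by (auto intro: continuous_on_open_Union)
qed auto

lemma C_diff_const: "C_diff k S (\<lambda>_. c)"
  by (induction k arbitrary: c) auto

lemma C_diff_bounded_linear:
  assumes "bounded_linear f" shows "C_diff k S f"
proof (cases k)
  case 0
  then show ?thesis using assms by (auto intro: linear_continuous_on)
next
  case (Suc j)
  have "(f has_derivative f) (at x)" for x
    using assms by (rule bounded_linear_imp_has_derivative)
  then have "f differentiable at x" "frechet_derivative f (at x) = f" for x
    by (auto simp: differentiable_def frechet_derivative_at[symmetric])
  then show ?thesis by (simp add: Suc C_diff_const)
qed

lemma C_diff_add:
  assumes "open S" "C_diff k S f" "C_diff k S g"
  shows "C_diff k S (\<lambda>x. f x + g x)"
  using assms(2,3)
proof (induction k arbitrary: f g)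
  case (Suc k)
  then have "C_diff k S (\<lambda>x. frechet_derivative f (at x) v + frechet_derivative g (at x) v)" for v
    by simp
  with Suc.prems show ?case
    by (intro C_diff_SucI[OF has_derivative_add[OF has_derivative_frechet has_derivative_frechet] assms(1)]) auto
qed (simp add: continuous_on_add)

lemma C_diff_sum:
  assumes "open S" "\<And>i. i \<in> I \<Longrightarrow> C_diff k S (f i)"
  shows "C_diff k S (\<lambda>x. \<Sum>i\<in>I. f i x)"
  using assms(2) by (induction I rule: infinite_finite_induct) (auto simp: C_diff_const C_diff_add assms(1))

text \<open>By the product rule the derivative is a sum of two values of \<open>h\<close>. In each
  of them the undifferentiated factor is lowered from order \<open>Suc k\<close> to
  \<open>k\<close>, so that the induction hypothesis applies.\<close>

lemma C_diff_bilinear: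
  assumes "bounded_bilinear h" "open S" "C_diff k S f" "C_diff k S g"
  shows "C_diff k S (\<lambda>x. h (f x) (g x))"
  using assms(3,4)
proof (induction k arbitrary: f g)
  case 0
  then show ?case using bounded_bilinear.continuous_on[OF assms(1)] by simp
next
  case (Suc k)
  have "C_diff k S (\<lambda>x. h (f x) (frechet_derivative g (at x) v) + h (frechet_derivative f (at x) v) (g x))" for v
    using Suc.prems Suc.prems[THEN C_diff_Suc_imp] by (intro C_diff_add assms(2) Suc.IH) simp_all
  with Suc.prems show ?case
    by (intro C_diff_SucI[OF bounded_bilinear.FDERIV[OF assms(1) has_derivative_frechet has_derivative_frechet] assms(2)]) auto
qed

section \<open>Closure properties of smooth maps\<close>

lemma smooth_on_cong:
  assumes "open S" "\<And>x. x \<in> S \<Longrightarrow> f x = g x" "smooth_on S f"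
  shows "smooth_on S g"
  using C_diff_cong[OF assms(1,2)] assms(3) by (simp add: smooth_on_def)

lemma smooth_on_subset: "smooth_on S f \<Longrightarrow> T \<subseteq> S \<Longrightarrow> smooth_on T f"
  by (auto simp: smooth_on_def intro: C_diff_subset)

lemma smooth_on_const: "smooth_on S (\<lambda>_. c)"
  by (simp add: smooth_on_def C_diff_const)

lemma smooth_on_sum:
  "open S \<Longrightarrow> (\<And>i. i \<in> I \<Longrightarrow> smooth_on S (f i)) \<Longrightarrow> smooth_on S (\<lambda>x. \<Sum>i\<in>I. f i x)"
  by (simp add: smooth_on_def C_diff_sum)

lemma smooth_on_bilinear:
  "bounded_bilinear h \<Longrightarrow> open S \<Longrightarrow> smooth_on S f \<Longrightarrow> smooth_on S g \<Longrightarrow> smooth_on S (\<lambda>x. h (f x) (g x))"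
  by (simp add: smooth_on_def C_diff_bilinear)

lemmas smooth_on_scaleR = smooth_on_bilinear[OF bounded_bilinear_scaleR]
lemmas smooth_on_inner = smooth_on_bilinear[OF bounded_bilinear_inner]

lemma smooth_on_ident: "smooth_on S (\<lambda>x. x)"
  by (simp add: smooth_on_def C_diff_bounded_linear bounded_linear_ident)

lemma smooth_on_add:
  "open S \<Longrightarrow> smooth_on S f \<Longrightarrow> smooth_on S g \<Longrightarrow> smooth_on S (\<lambda>x. f x + g x)"
  by (simp add: smooth_on_def C_diff_add)

lemma smooth_on_diff:
  assumes "open S" "smooth_on S f" "smooth_on S g" shows "smooth_on S (\<lambda>x. f x - g x)"
  using smooth_on_add[OF assms(1,2) smooth_on_scaleR[OF assms(1) smooth_on_const assms(3), of "-1"]]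
  by simp

lemma smooth_on_Un:
  assumes "open S" "open T" "smooth_on S f" "smooth_on T f" shows "smooth_on (S \<union> T) f"
  using C_diff_Union[of "{S, T}"] assms by (auto simp: smooth_on_def)

lemma smooth_on_frechet: "smooth_on S f \<Longrightarrow> smooth_on S (\<lambda>x. frechet_derivative f (at x) v)"
  unfolding smooth_on_def by (metis C_diff.simps(2))

lemma smooth_on_imp_differentiable: "smooth_on S f \<Longrightarrow> x \<in> S \<Longrightarrow> f differentiable at x"
  unfolding smooth_on_def by (metis C_diff.simps(2))

lemma smooth_on_has_derivative:
  "smooth_on S f \<Longrightarrow> x \<in> S \<Longrightarrow> (f has_derivative frechet_derivative f (at x)) (at x)"
  by (intro has_derivative_frechet smooth_on_imp_differentiable)

section \<open>Finite-dimensional inner product spaces\<close>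

text \<open>An explicit orthonormal basis takes the place of a type class on the model space.
  Coordinates become inner products, and dimension 0 is the case \<open>B = {}\<close>.\<close>

locale orthonormal_basis =
  fixes B :: "'e::real_inner set"
  assumes finite_B: "finite B"
    and inner_B: "b \<in> B \<Longrightarrow> b' \<in> B \<Longrightarrow> b \<bullet> b' = (if b = b' then 1 else 0)"
    and span_B: "span B = UNIV"

lemma orthonormal_basis_exists:
  fixes S :: "'e::real_inner set"
  assumes "finite S" "span S = UNIV"
  shows "\<exists>B::'e set. orthonormal_basis B"
proof -
  obtain C :: "'e set" where C: "finite C" "span C = UNIV" "pairwise orthogonal C"
    using basis_orthogonal[OF assms(1)] assms(2) by auto
  \<comment> \<open>The orthogonal set \<open>C\<close> may contain 0, which cannot be normalised;
    dropping it does not change the span.\<close>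
  define B where "B = (\<lambda>x. x /\<^sub>R norm x) ` (C - {0})"
  have "span B = span (C - {0})"
    unfolding B_def using C(1) by (intro span_image_scale) auto
  then have "span B = UNIV" using C(2) by simp
  moreover have "b \<bullet> b' = (if b = b' then 1 else 0)" if bb': "b \<in> B" "b' \<in> B" for b b'
  proof -
    obtain x y where xy: "x \<in> C" "x \<noteq> 0" "y \<in> C" "y \<noteq> 0" "b = x /\<^sub>R norm x" "b' = y /\<^sub>R norm y"
      using bb' by (auto simp: B_def)
    show ?thesis
    proof (cases "x = y")
      case True
      then show ?thesis using xy by (simp add: dot_square_norm power2_eq_square)
    next
      case False
      then have "x \<bullet> y = 0" using C(3) xy by (auto simp: pairwise_def orthogonal_def)
      then have "b \<bullet> b' = 0" using xy by simp
      moreover have "b \<bullet> b \<noteq> 0" using xy by simp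
      ultimately show ?thesis by auto
    qed
  qed
  ultimately have "orthonormal_basis B"
    using C(1) by unfold_locales (auto simp: B_def)
  then show ?thesis ..
qed

context orthonormal_basis
begin

lemma expansion: "(\<Sum>b\<in>B. (v \<bullet> b) *\<^sub>R b) = v"
proof -
  have "v \<in> span B" by (simp add: span_B)
  then obtain u where u: "v = (\<Sum>b\<in>B. u b *\<^sub>R b)"
    using span_finite[OF finite_B] by auto
  have "v \<bullet> c = u c" if "c \<in> B" for c
  proof -
    have "v \<bullet> c = (\<Sum>b\<in>B. u b * (b \<bullet> c))" by (simp add: u inner_sum_left)
    also have "\<dots> = (\<Sum>b\<in>B. if b = c then u b else 0)"
      using that by (intro sum.cong) (auto simp: inner_B)
    finally show ?thesis using that finite_B by simp
  qed
  then show ?thesis using u by simp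
qed

text \<open>\<open>C_diff\<close> speaks of derivatives along fixed vectors only. This expansion
  turns the value of a linear map at a moving vector into a finite sum of values at basis vectors,
  to which the product rule applies.\<close>

lemma linear_expansion: "linear f \<Longrightarrow> f v = (\<Sum>b\<in>B. (v \<bullet> b) *\<^sub>R f b)"
  by (subst expansion[symmetric], subst linear_sum) (auto simp: linear_scale)

lemma independent_B: "independent B"
proof -
  have "0 \<notin> B" using inner_B[of 0 0] by auto
  moreover have "pairwise orthogonal B" by (simp add: pairwise_def orthogonal_def inner_B)
  ultimately show ?thesis by (rule pairwise_orthogonal_independent[rotated])
qed

lemma eq_by_inner_B:
  assumes "\<And>b. b \<in> B \<Longrightarrow> v \<bullet> b = w \<bullet> b"
  shows "v = w"
proof -
  have "(\<Sum>b\<in>B. (v \<bullet> b) *\<^sub>R b) = (\<Sum>b\<in>B. (w \<bullet> b) *\<^sub>R b)"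
    using assms by (intro sum.cong) auto
  then show ?thesis by (simp only: expansion)
qed

text \<open>The combinations of \<open>B\<close> with coefficients in \<open>{-r..r}\<close> form a
  finite sum of compact segments. By Cauchy-Schwarz the closed ball around 0 lies in this compact
  set, and a translation moves the centre.\<close>

lemma compact_cball: "compact (cball x (r::real))" for x :: 'e
proof -
  let ?K = "\<lambda>C::'e set. {v. \<exists>a. (\<forall>b\<in>C. a b \<in> {-r..r}) \<and> v = (\<Sum>b\<in>C. a b *\<^sub>R b)}"
  have *: "compact (?K C)" if "finite C" for C :: "'e set"
    using that
  proof (induction C rule: finite_induct)
    case (insert c C)
    have "compact ((\<lambda>t. t *\<^sub>R c) ` {-r..r})"
      by (intro compact_continuous_image continuous_intros) auto
    then have K: "compact {p + q | p q. p \<in> (\<lambda>t. t *\<^sub>R c) ` {-r..r} \<and> q \<in> ?K C}"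
      using insert by (intro compact_sums) auto
    have "?K (insert c C) = {p + q | p q. p \<in> (\<lambda>t. t *\<^sub>R c) ` {-r..r} \<and> q \<in> ?K C}" (is "_ = ?R")
    proof (intro equalityI subsetI)
      fix v assume "v \<in> ?K (insert c C)"
      then obtain a where a: "\<forall>b\<in>insert c C. a b \<in> {-r..r}" "v = (\<Sum>b\<in>insert c C. a b *\<^sub>R b)"
        by blast
      then have "v = a c *\<^sub>R c + (\<Sum>b\<in>C. a b *\<^sub>R b)" using insert.hyps by simp
      with a(1) show "v \<in> ?R" by blast
    next
      fix v assume "v \<in> ?R"
      then obtain t a where t: "t \<in> {-r..r}" "\<forall>b\<in>C. a b \<in> {-r..r}" "v = t *\<^sub>R c + (\<Sum>b\<in>C. a b *\<^sub>R b)"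
        by blast
      have "(\<Sum>b\<in>C. (a(c := t)) b *\<^sub>R b) = (\<Sum>b\<in>C. a b *\<^sub>R b)"
        using insert.hyps by (intro sum.cong) auto
      then have "v = (\<Sum>b\<in>insert c C. (a(c := t)) b *\<^sub>R b)"
        using insert.hyps t(3) by simp
      moreover have "\<forall>b\<in>insert c C. (a(c := t)) b \<in> {-r..r}" using t by simp
      ultimately show "v \<in> ?K (insert c C)" by blast
    qed
    with K show ?case by simp
  qed simp
  have norm_B: "norm b = 1" if "b \<in> B" for b
    using inner_B[of b b] that by (simp add: norm_eq_sqrt_inner)
  have "cball 0 r \<subseteq> ?K B"
  proof
    fix v :: 'e assume v: "v \<in> cball 0 r"
    have "v \<bullet> b \<in> {-r..r}" if "b \<in> B" for b
      using v Cauchy_Schwarz_ineq2[of v b] norm_B[OF that] by (simp add: abs_le_iff)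
    then have "\<forall>b\<in>B. v \<bullet> b \<in> {-r..r}" by blast
    then show "v \<in> ?K B"
      using expansion[of v, symmetric] by (intro CollectI exI[of _ "\<lambda>b. v \<bullet> b"] conjI)
  qed
  then have "compact (cball (0::'e) r)"
    using compact_Int_closed[OF *[OF finite_B] closed_cball[of 0 r]] by (simp add: Int_absorb1)
  then show ?thesis using compact_translation[of "cball 0 r" x] by simp
qed

text \<open>The chain rule differentiates \<open>g\<close> along the moving vector
  \<open>frechet_derivative f (at x) v\<close>. Expanded in \<open>B\<close>, only derivatives of
  \<open>g\<close> along fixed \<open>b\<close>, composed with \<open>f\<close>, remain, and the
  induction hypothesis covers these. Hence the space in the middle is \<open>'e\<close>.\<close>

lemma C_diff_compose:
  assumes "open S" "open T" "f ` S \<subseteq> T" "C_diff k S f" "C_diff k T g"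
  shows "C_diff k S (\<lambda>x. g (f x :: 'e))"
  using assms(4,5)
proof (induction k arbitrary: g)
  case 0
  then show ?case using assms(3) by (auto intro: continuous_on_compose2)
next
  case (Suc k)
  have f: "(f has_derivative frechet_derivative f (at x)) (at x)"
    and g: "(g has_derivative frechet_derivative g (at (f x))) (at (f x))" if "x \<in> S" for x
    using Suc.prems that assms(3) by (auto intro!: has_derivative_frechet)
  have "C_diff k S (\<lambda>x. frechet_derivative g (at (f x)) b)" for b
    using Suc.prems C_diff_Suc_imp[OF Suc.prems(1)] by (intro Suc.IH) auto
  then have "C_diff k S (\<lambda>x. \<Sum>b\<in>B. (frechet_derivative f (at x) v \<bullet> b) *\<^sub>R frechet_derivative g (at (f x)) b)" for v
    using Suc.prems assms(1)
    by (intro C_diff_sum C_diff_bilinear[OF bounded_bilinear_scaleR]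
        C_diff_bilinear[OF bounded_bilinear_inner] C_diff_const) auto
  then have "C_diff k S (\<lambda>x. frechet_derivative g (at (f x)) (frechet_derivative f (at x) v))" for v
  proof (rule C_diff_cong[OF assms(1), rotated])
    fix x assume "x \<in> S"
    show "(\<Sum>b\<in>B. (frechet_derivative f (at x) v \<bullet> b) *\<^sub>R frechet_derivative g (at (f x)) b) =
      frechet_derivative g (at (f x)) (frechet_derivative f (at x) v)"
      using linear_expansion[OF has_derivative_linear[OF g[OF \<open>x \<in> S\<close>]], of "frechet_derivative f (at x) v"]
      by (rule sym)
  qed
  moreover have "((\<lambda>x. g (f x)) has_derivative
      (\<lambda>v. frechet_derivative g (at (f x)) (frechet_derivative f (at x) v))) (at x)" if "x \<in> S" for x
    by (rule has_derivative_compose[OF f[OF that] g[OF that]])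
  ultimately show ?case
    using C_diff_SucI[where f' = "\<lambda>x v. frechet_derivative g (at (f x)) (frechet_derivative f (at x) v)"] assms(1)
    by blast
qed

lemma smooth_on_compose:
  "open S \<Longrightarrow> open T \<Longrightarrow> f ` S \<subseteq> T \<Longrightarrow> smooth_on S f \<Longrightarrow> smooth_on T g \<Longrightarrow>
    smooth_on S (\<lambda>x. g (f x :: 'e))"
  by (simp add: smooth_on_def C_diff_compose[where T = T])

lemma smooth_on_frechet_apply:
  assumes "open S" "smooth_on S f" "smooth_on S u"
  shows "smooth_on S (\<lambda>x :: 'e. frechet_derivative f (at x) (u x))"
proof -
  have "smooth_on S (\<lambda>x. \<Sum>b\<in>B. (u x \<bullet> b) *\<^sub>R frechet_derivative f (at x) b)"
    using assms
    by (intro smooth_on_sum smooth_on_scaleR smooth_on_inner smooth_on_frechet smooth_on_const) auto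
  then show ?thesis
  proof (rule smooth_on_cong[OF assms(1), rotated])
    fix x assume "x \<in> S"
    show "(\<Sum>b\<in>B. (u x \<bullet> b) *\<^sub>R frechet_derivative f (at x) b) = frechet_derivative f (at x) (u x)"
      using linear_expansion[OF has_derivative_linear[OF smooth_on_has_derivative[OF assms(2) \<open>x \<in> S\<close>]], of "u x"]
      by (rule sym)
  qed
qed

end

section \<open>Symmetry of second derivatives\<close>

lemma has_real_derivative_along_line:
  assumes "(g has_derivative g') (at (y + t *\<^sub>R w))"
  shows "((\<lambda>t. g (y + t *\<^sub>R w)) has_real_derivative g' w) (at t)"
proof -
  interpret bounded_linear g' by (rule has_derivative_bounded_linear[OF assms])
  have "((\<lambda>t. y + t *\<^sub>R w) has_derivative (\<lambda>h. h *\<^sub>R w)) (at t)"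
    by (auto intro!: derivative_eq_intros)
  from has_derivative_compose[OF this assms] show ?thesis
    by (simp add: has_field_derivative_def scaleR mult_commute_abs)
qed

text \<open>The mean value theorem is applied twice: along \<open>v\<close> to the difference of
  \<open>f\<close> on two parallel segments, then along \<open>w\<close> to the derivative of
  \<open>f\<close> in direction \<open>v\<close>.\<close>

lemma second_difference:
  fixes f :: "'a::real_normed_vector \<Rightarrow> real"
  assumes f: "C_diff (Suc (Suc 0)) S f" and S: "ball x r \<subseteq> S"
    and h: "h > 0" "h * (norm v + norm w) < r"
  shows "\<exists>y\<in>ball x r. f (x + h *\<^sub>R v + h *\<^sub>R w) - f (x + h *\<^sub>R v) - f (x + h *\<^sub>R w) + f x =
    h * (h * frechet_derivative (\<lambda>z. frechet_derivative f (at z) v) (at y) w)"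
proof -
  have near: "x + s *\<^sub>R v + t *\<^sub>R w \<in> ball x r" if "0 \<le> s" "s \<le> h" "0 \<le> t" "t \<le> h" for s t
  proof -
    have "norm (s *\<^sub>R v + t *\<^sub>R w) \<le> s * norm v + t * norm w"
      using that norm_triangle_ineq[of "s *\<^sub>R v" "t *\<^sub>R w"] by simp
    also have "\<dots> \<le> h * norm v + h * norm w"
      using that by (intro add_mono mult_right_mono) auto
    finally have "norm (s *\<^sub>R v + t *\<^sub>R w) < r" using h(2) by (simp add: algebra_simps)
    then show ?thesis by (simp add: dist_norm add.assoc norm_minus_commute add.commute[of "t *\<^sub>R w"])
  qed
  have D1: "(f has_derivative frechet_derivative f (at y)) (at y)"
    and D2: "((\<lambda>z. frechet_derivative f (at z) v) has_derivative
      frechet_derivative (\<lambda>z. frechet_derivative f (at z) v) (at y)) (at y)" if "y \<in> ball x r" for y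
    using f S that by (auto intro!: has_derivative_frechet)
  have "((\<lambda>s. f (x + h *\<^sub>R w + s *\<^sub>R v) - f (x + s *\<^sub>R v)) has_real_derivative
      frechet_derivative f (at (x + h *\<^sub>R w + s *\<^sub>R v)) v - frechet_derivative f (at (x + s *\<^sub>R v)) v) (at s)"
    if "0 \<le> s" "s \<le> h" for s
    using near[of s h] near[of s 0] that h
    by (intro DERIV_diff has_real_derivative_along_line D1) (auto simp: algebra_simps)
  from MVT2[OF h(1) this] obtain s where s: "0 < s" "s < h"
    "f (x + h *\<^sub>R w + h *\<^sub>R v) - f (x + h *\<^sub>R v) - (f (x + h *\<^sub>R w) - f x) =
      h * (frechet_derivative f (at (x + h *\<^sub>R w + s *\<^sub>R v)) v - frechet_derivative f (at (x + s *\<^sub>R v)) v)"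
    by auto
  have "((\<lambda>t. frechet_derivative f (at (x + s *\<^sub>R v + t *\<^sub>R w)) v) has_real_derivative
      frechet_derivative (\<lambda>z. frechet_derivative f (at z) v) (at (x + s *\<^sub>R v + t *\<^sub>R w)) w) (at t)"
    if "0 \<le> t" "t \<le> h" for t
    using near[of s t] that s by (intro has_real_derivative_along_line D2) auto
  from MVT2[OF h(1) this] obtain t where t: "0 < t" "t < h"
    "frechet_derivative f (at (x + s *\<^sub>R v + h *\<^sub>R w)) v - frechet_derivative f (at (x + s *\<^sub>R v)) v =
      h * frechet_derivative (\<lambda>z. frechet_derivative f (at z) v) (at (x + s *\<^sub>R v + t *\<^sub>R w)) w"
    by auto
  show ?thesis
    using s t near[of s t] by (intro bexI[of _ "x + s *\<^sub>R v + t *\<^sub>R w"]) (simp_all add: algebra_simps)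
qed

text \<open>The second difference is symmetric in \<open>v\<close> and \<open>w\<close>, so one
  mixed derivative at some point near \<open>x\<close> equals the other at some other point near
  \<open>x\<close>. Continuity carries the equality to \<open>x\<close>.\<close>

lemma second_derivative_symmetric_real:
  fixes f :: "'a::real_normed_vector \<Rightarrow> real"
  assumes f: "C_diff (Suc (Suc 0)) S f" and S: "open S" "x \<in> S"
  shows "frechet_derivative (\<lambda>z. frechet_derivative f (at z) v) (at x) w =
    frechet_derivative (\<lambda>z. frechet_derivative f (at z) w) (at x) v"
proof -
  define P where "P v w y = frechet_derivative (\<lambda>z. frechet_derivative f (at z) v) (at y) w" for v w y
  have cont: "isCont (P v w) x" for v w
    using f S unfolding P_def[abs_def] by (auto simp: continuous_on_eq_continuous_at)
  have "\<bar>P v w x - P w v x\<bar> \<le> 2 * e" if "e > 0" for e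
  proof -
    obtain d1 where d1: "d1 > 0" "\<And>y. dist y x < d1 \<Longrightarrow> dist (P v w y) (P v w x) < e"
      using cont[of v w] \<open>e > 0\<close> unfolding continuous_at_eps_delta by blast
    obtain d2 where d2: "d2 > 0" "\<And>y. dist y x < d2 \<Longrightarrow> dist (P w v y) (P w v x) < e"
      using cont[of w v] \<open>e > 0\<close> unfolding continuous_at_eps_delta by blast
    obtain d3 where d3: "d3 > 0" "ball x d3 \<subseteq> S"
      using S by (meson openE)
    define r where "r = min d1 (min d2 d3)"
    have r: "r > 0" "ball x r \<subseteq> S" using d1 d2 d3 by (auto simp: r_def)
    \<comment> \<open>Small enough for the parallelogram with sides \<open>h *\<^sub>R v\<close> and
      \<open>h *\<^sub>R w\<close> to stay in the ball; the \<open>+ 1\<close> keeps the denominator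
      positive when both vectors are 0.\<close>
    define h where "h = r / (2 * (norm v + norm w + 1))"
    have "norm v + norm w + 1 > 0" by (simp add: add_nonneg_pos)
    then have h: "h > 0" "h * (norm v + norm w) < r"
      using r(1) by (auto simp: h_def field_simps add_nonneg_pos)
    obtain y where y: "y \<in> ball x r"
      "f (x + h *\<^sub>R v + h *\<^sub>R w) - f (x + h *\<^sub>R v) - f (x + h *\<^sub>R w) + f x = h * (h * P v w y)"
      using second_difference[OF f r(2) h] unfolding P_def by blast
    obtain z where z: "z \<in> ball x r"
      "f (x + h *\<^sub>R w + h *\<^sub>R v) - f (x + h *\<^sub>R w) - f (x + h *\<^sub>R v) + f x = h * (h * P w v z)"
      using second_difference[OF f r(2) h(1), of w v] h(2) unfolding P_def by (auto simp: add.commute)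
    have "h * (h * P v w y) = h * (h * P w v z)"
      using y(2) z(2) unfolding add.assoc[of x] add.commute[of "h *\<^sub>R w" "h *\<^sub>R v"] by linarith
    then have "P v w y = P w v z" using h(1) by simp
    moreover have "dist (P v w y) (P v w x) < e" "dist (P w v z) (P w v x) < e"
      using y(1) z(1) d1(2)[of y] d2(2)[of z] by (simp_all add: r_def dist_commute[of x])
    ultimately show ?thesis by (simp add: dist_real_def abs_if split: if_splits)
  qed
  \<comment> \<open>With \<open>e\<close> a quarter of a positive gap, the gap would be at most half
    of itself.\<close>
  from this[of "\<bar>P v w x - P w v x\<bar> / 4"] have "P v w x = P w v x" by (cases "P v w x = P w v x") auto
  then show ?thesis by (simp add: P_def)
qed

lemma (in orthonormal_basis) second_derivative_symmetric:
  fixes f :: "'a::real_normed_vector \<Rightarrow> 'e"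
  assumes f: "smooth_on S f" and S: "open S" "x \<in> S"
  shows "frechet_derivative (\<lambda>z. frechet_derivative f (at z) v) (at x) w =
    frechet_derivative (\<lambda>z. frechet_derivative f (at z) w) (at x) v"
proof (rule eq_by_inner_B)
  fix b assume "b \<in> B"
  have *: "frechet_derivative (\<lambda>z. g z \<bullet> b) (at y) u = frechet_derivative g (at y) u \<bullet> b"
    if "smooth_on S g" "y \<in> S" for g :: "'a \<Rightarrow> 'e" and y u
    using bounded_linear.has_derivative[OF bounded_linear_inner_left smooth_on_has_derivative[OF that], of b]
    by (simp add: frechet_derivative_at[symmetric])
  have **: "frechet_derivative (\<lambda>z. frechet_derivative (\<lambda>z. f z \<bullet> b) (at z) v) (at x) w =
      frechet_derivative (\<lambda>z. frechet_derivative f (at z) v) (at x) w \<bullet> b" for v w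
    using *[OF f] S *[OF smooth_on_frechet[OF f] S(2)]
    by (subst frechet_derivative_cong_open[OF S, where g = "\<lambda>z. frechet_derivative f (at z) v \<bullet> b"]) auto
  have "smooth_on S (\<lambda>z. f z \<bullet> b)" by (intro smooth_on_inner f S smooth_on_const)
  then have "C_diff (Suc (Suc 0)) S (\<lambda>z. f z \<bullet> b)" unfolding smooth_on_def by blast
  from second_derivative_symmetric_real[OF this S, of v w]
  show "frechet_derivative (\<lambda>z. frechet_derivative f (at z) v) (at x) w \<bullet> b =
      frechet_derivative (\<lambda>z. frechet_derivative f (at z) w) (at x) v \<bullet> b"
    by (simp only: **)
qed

section \<open>A smooth bump function\<close>

text \<open>The derivatives of \<open>exp (- 1 / t)\<close> are combinations of the functions \<open>flat m\<close>.\<close>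

definition flat :: "nat \<Rightarrow> real \<Rightarrow> real" where
  "flat m t = (if t > 0 then inverse t ^ m * exp (- inverse t) else 0)"

text \<open>Substituting \<open>inverse t\<close> reduces this to the decay of
  \<open>u ^ m / exp u\<close> at infinity.\<close>

lemma tendsto_flat_right: "(flat m \<longlongrightarrow> 0) (at_right 0)"
proof -
  have "((\<lambda>t::real. inverse t ^ m / exp (inverse t)) \<longlongrightarrow> 0) (at_right 0)"
    by (rule filterlim_compose[OF tendsto_power_div_exp_0 filterlim_inverse_at_top_right])
  then show ?thesis
    by (rule Lim_transform_eventually)
      (auto simp: flat_def eventually_at_filter exp_minus field_simps)
qed

lemma DERIV_flat: "(flat m has_real_derivative flat (m + 2) t - real m * flat (m + 1) t) (at t)"
proof -
  consider "t > 0" | "t < 0" | "t = 0" by linarith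
  then show ?thesis
  proof cases
    case 1
    have "((\<lambda>t. inverse t ^ m * exp (- inverse t)) has_real_derivative
        inverse t ^ (m + 2) * exp (- inverse t) - real m * (inverse t ^ (m + 1) * exp (- inverse t))) (at t)"
    proof -
      have "((\<lambda>t. inverse t ^ m) has_real_derivative - real m * inverse t ^ (m + 1)) (at t)"
        using DERIV_power[OF DERIV_inverse[of t UNIV], of m] 1 by (cases m) (auto simp: algebra_simps)
      moreover have "((\<lambda>t. exp (- inverse t)) has_real_derivative inverse t ^ 2 * exp (- inverse t)) (at t)"
        using 1 by (auto intro!: derivative_eq_intros simp: power2_eq_square)
      ultimately show ?thesis
        by (rule DERIV_cong[OF DERIV_mult]) (simp add: algebra_simps power_add power2_eq_square)
    qed
    then have "(flat m has_real_derivative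
        inverse t ^ (m + 2) * exp (- inverse t) - real m * (inverse t ^ (m + 1) * exp (- inverse t))) (at t)"
      by (rule has_field_derivative_transform_within_open[of _ _ _ "{0<..}"]) (use 1 in \<open>auto simp: flat_def\<close>)
    then show ?thesis using 1 by (simp add: flat_def)
  next
    case 2
    have "(flat m has_real_derivative 0) (at t)"
      by (rule has_field_derivative_transform_within_open[OF DERIV_const, of "{..<0}"])
        (use 2 in \<open>auto simp: flat_def\<close>)
    then show ?thesis using 2 by (simp add: flat_def)
  next
    case 3
    \<comment> \<open>At 0 the difference quotient equals \<open>flat (Suc m)\<close> on the right
      and vanishes on the left.\<close>
    have "((\<lambda>y. flat m y / y) \<longlongrightarrow> 0) (at_right 0)"
      by (rule Lim_transform_eventually[OF tendsto_flat_right[of "Suc m"]])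
        (auto simp: flat_def eventually_at_filter field_simps)
    moreover have "((\<lambda>y. flat m y / y) \<longlongrightarrow> 0) (at_left 0)"
      by (rule Lim_transform_eventually[OF tendsto_const]) (auto simp: flat_def eventually_at_filter)
    ultimately have "((\<lambda>y. flat m y / y) \<longlongrightarrow> 0) (at 0)"
      by (simp add: filterlim_split_at)
    then show ?thesis using 3 by (simp add: DERIV_def flat_def)
  qed
qed

lemma C_diff_flat: "C_diff k UNIV (flat m)"
proof (induction k arbitrary: m)
  case 0
  then show ?case by (auto intro!: continuous_at_imp_continuous_on DERIV_isCont[OF DERIV_flat])
next
  case (Suc k)
  have "(flat m has_derivative (\<lambda>v. (flat (m + 2) t + (- real m) * flat (m + 1) t) * v)) (at t)" for t
    using DERIV_flat[of m t] by (simp add: has_field_derivative_def)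
  moreover have "C_diff k UNIV (\<lambda>t. (flat (m + 2) t + (- real m) * flat (m + 1) t) * v)" for v
    by (intro C_diff_bilinear[OF bounded_bilinear_mult] C_diff_add C_diff_const Suc.IH open_UNIV)
  ultimately show ?case
    using C_diff_SucI[where f' = "\<lambda>t v. (flat (m + 2) t + (- real m) * flat (m + 1) t) * v"] by blast
qed

text \<open>The squared distance, unlike the distance, is smooth at the centre. The value at
  \<open>x0\<close> is positive but not normalised to 1, so a field cut off by \<open>bump\<close>
  has to be rescaled.\<close>

definition bump :: "'e::real_inner \<Rightarrow> real \<Rightarrow> 'e \<Rightarrow> real" where
  "bump x0 r x = flat 0 (r\<^sup>2 - (x - x0) \<bullet> (x - x0))"

lemma smooth_on_bump: "smooth_on UNIV (bump x0 r)"
proof -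
  \<comment> \<open>\<open>smooth_on_compose\<close> asks for an orthonormal basis of the space in
    the middle, which is \<open>real\<close> here.\<close>
  interpret orthonormal_basis "{1::real}"
    by unfold_locales (auto simp: span_singleton)
  have "smooth_on UNIV (\<lambda>x. r\<^sup>2 - (x - x0) \<bullet> (x - x0))"
    by (intro smooth_on_diff smooth_on_inner smooth_on_const smooth_on_ident open_UNIV)
  then show ?thesis
    unfolding bump_def
    by (rule smooth_on_compose[where T = UNIV and g = "flat 0", rotated 3]) (auto simp: smooth_on_def C_diff_flat)
qed

lemma bump_center: "r > 0 \<Longrightarrow> bump x0 r x0 > 0"
  by (simp add: bump_def flat_def)

lemma bump_eq_0: "r \<ge> 0 \<Longrightarrow> x \<notin> ball x0 r \<Longrightarrow> bump x0 r x = 0"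
  by (auto simp: bump_def flat_def dist_norm norm_minus_commute dot_square_norm not_less abs_le_square_iff[symmetric])

section \<open>Charts and tangent vectors\<close>

locale manifold = orthonormal_basis B
  for B :: "'e::real_inner set" +
  fixes A :: "('m::{t2_space, second_countable_topology}, 'e) chart set"
  assumes smooth_manifold: "smooth_manifold A"
begin

lemma chart_cover: "\<exists>c\<in>A. p \<in> dom_of c"
  using smooth_manifold unfolding smooth_manifold_def by blast

lemma chart_at: "chart_at A p \<in> A" "p \<in> dom_of (chart_at A p)"
proof -
  have "\<exists>c. c \<in> A \<and> p \<in> dom_of c" using chart_cover by blast
  from someI_ex[OF this] show "chart_at A p \<in> A" "p \<in> dom_of (chart_at A p)"
    unfolding chart_at_def by blast+
qed

context
  fixes c assumes c: "c \<in> A"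
begin

lemma open_dom: "open (dom_of c)"
  using smooth_manifold c unfolding smooth_manifold_def by blast

lemma open_img: "open (img_of c)"
  using smooth_manifold c unfolding smooth_manifold_def by blast

lemma homeomorphism_chart: "homeomorphism (dom_of c) (img_of c) (snd c) (inv_of c)"
  using smooth_manifold c unfolding smooth_manifold_def by blast

lemma inv_chart: "p \<in> dom_of c \<Longrightarrow> inv_of c (snd c p) = p"
  using homeomorphism_chart by (rule homeomorphism_apply1)

lemma open_chart_image: "open U \<Longrightarrow> open (snd c ` (dom_of c \<inter> U))"
proof -
  assume "open U"
  then have "openin (top_of_set (dom_of c)) (dom_of c \<inter> U)" by (rule openin_open_Int)
  from homeomorphism_imp_open_map[OF homeomorphism_chart this]
  show "open (snd c ` (dom_of c \<inter> U))"
    using open_img by (rule openin_open_trans)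
qed

end

section \<open>Transition maps and their Jacobians\<close>

definition transition :: "('m, 'e) chart \<Rightarrow> ('m, 'e) chart \<Rightarrow> 'e \<Rightarrow> 'e" where
  "transition c c' = snd c' \<circ> inv_of c"

definition jac :: "('m, 'e) chart \<Rightarrow> ('m, 'e) chart \<Rightarrow> 'e \<Rightarrow> 'e \<Rightarrow> 'e" where
  "jac c c' x = frechet_derivative (transition c c') (at x)"

lemma transition_chart: "c \<in> A \<Longrightarrow> p \<in> dom_of c \<Longrightarrow> transition c c' (snd c p) = snd c' p"
  by (simp add: transition_def inv_chart)

lemma smooth_transition: "c \<in> A \<Longrightarrow> c' \<in> A \<Longrightarrow> smooth_on (snd c ` (dom_of c \<inter> dom_of c')) (transition c c')"
  using smooth_manifold unfolding smooth_manifold_def transition_def by blast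

lemma has_derivative_transition:
  assumes "c \<in> A" "c' \<in> A" "p \<in> dom_of c" "p \<in> dom_of c'"
  shows "(transition c c' has_derivative jac c c' (snd c p)) (at (snd c p))"
  unfolding jac_def by (rule smooth_on_has_derivative[OF smooth_transition]) (use assms in auto)

lemma linear_jac:
  "c \<in> A \<Longrightarrow> c' \<in> A \<Longrightarrow> p \<in> dom_of c \<Longrightarrow> p \<in> dom_of c' \<Longrightarrow> linear (jac c c' (snd c p))"
  using has_derivative_transition by (rule has_derivative_linear)

text \<open>Near \<open>snd c p\<close> the composite of two transition maps is the third one; the
  chain rule and uniqueness of derivatives give the cocycle rule.\<close>

lemma jac_chain:
  assumes "c \<in> A" "c' \<in> A" "c'' \<in> A" "p \<in> dom_of c" "p \<in> dom_of c'" "p \<in> dom_of c''"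
  shows "jac c' c'' (snd c' p) (jac c c' (snd c p) e) = jac c c'' (snd c p) e"
proof -
  have "(transition c' c'' has_derivative jac c' c'' (snd c' p)) (at (transition c c' (snd c p)))"
    using has_derivative_transition[of c' c'' p] assms by (simp add: transition_chart)
  from has_derivative_compose[OF has_derivative_transition[of c c' p] this]
  have "((\<lambda>x. transition c' c'' (transition c c' x)) has_derivative
      (\<lambda>e. jac c' c'' (snd c' p) (jac c c' (snd c p) e))) (at (snd c p))"
    using assms by simp
  then have "(transition c c'' has_derivative
      (\<lambda>e. jac c' c'' (snd c' p) (jac c c' (snd c p) e))) (at (snd c p))"
    by (rule has_derivative_transform_within_open[of _ _ _ _ "snd c ` (dom_of c \<inter> dom_of c')"])
      (use assms in \<open>auto simp: open_chart_image open_dom transition_chart\<close>)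
  from has_derivative_unique[OF this has_derivative_transition[OF assms(1,3,4,6)]]
  show ?thesis by (rule fun_cong)
qed

lemma jac_self:
  assumes "c \<in> A" "p \<in> dom_of c"
  shows "jac c c (snd c p) e = e"
proof -
  have "(transition c c has_derivative (\<lambda>e. e)) (at (snd c p))"
    by (rule has_derivative_transform_within_open[OF has_derivative_ident, of "img_of c"])
      (use assms in \<open>auto simp: open_img transition_chart\<close>)
  from has_derivative_unique[OF has_derivative_transition[OF assms(1,1,2,2)] this]
  show ?thesis by (rule fun_cong)
qed

section \<open>Tangent vectors in coordinates\<close>

lemma tangent_space_iff:
  "v \<in> tangent_space A p \<longleftrightarrow> (\<forall>c. \<not> (c \<in> A \<and> p \<in> dom_of c) \<longrightarrow> v c = 0) \<and>
    (\<forall>c\<in>A. \<forall>c'\<in>A. p \<in> dom_of c \<inter> dom_of c' \<longrightarrow> v c' = jac c c' (snd c p) (v c))"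
  unfolding tangent_space_def jac_def transition_def by (rule mem_Collect_eq)

lemma tangent_jac:
  "v \<in> tangent_space A p \<Longrightarrow> c \<in> A \<Longrightarrow> c' \<in> A \<Longrightarrow> p \<in> dom_of c \<Longrightarrow> p \<in> dom_of c' \<Longrightarrow>
    jac c c' (snd c p) (v c) = v c'"
  unfolding tangent_space_iff by (rule sym) blast

lemma tangent_outside: "v \<in> tangent_space A p \<Longrightarrow> \<not> (c \<in> A \<and> p \<in> dom_of c) \<Longrightarrow> v c = 0"
  unfolding tangent_space_iff by blast

lemma coord_tvec_eq:
  "coord_tvec A c p e = (\<lambda>c'. if c' \<in> A \<and> p \<in> dom_of c' then jac c c' (snd c p) e else 0)"
  by (auto simp: fun_eq_iff coord_tvec_def jac_def transition_def)

context
  fixes c p assumes c: "c \<in> A" and p: "p \<in> dom_of c"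
begin

lemma coord_tvec_in [simp, intro]: "coord_tvec A c p e \<in> tangent_space A p"
  using c p by (auto simp: tangent_space_iff coord_tvec_eq jac_chain)

lemma coord_tvec_self [simp]: "coord_tvec A c p e c = e"
  using c p by (simp add: coord_tvec_eq jac_self)

lemma coord_tvec_tangent:
  assumes v: "v \<in> tangent_space A p"
  shows "coord_tvec A c p (v c) = v"
proof
  fix c' show "coord_tvec A c p (v c) c' = v c'"
    using tangent_jac[OF v c _ p, of c'] tangent_outside[OF v, of c'] by (auto simp: coord_tvec_eq)
qed

lemma linear_coord_tvec: "linear (coord_tvec A c p)"
  by (rule linearI)
    (auto simp: coord_tvec_eq scaleR_fun_def fun_eq_iff linear_add linear_scale linear_jac c p)

lemma tangent_space_eq_range: "tangent_space A p = range (coord_tvec A c p)"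
proof (intro equalityI subsetI)
  fix v assume "v \<in> tangent_space A p"
  from coord_tvec_tangent[OF this] show "v \<in> range (coord_tvec A c p)" by (metis rangeI)
qed auto

lemma map_coord_tvec:
  "set vs \<subseteq> tangent_space A p \<Longrightarrow> map (coord_tvec A c p) (map (\<lambda>v. v c) vs) = vs"
  by (induction vs) (auto simp: coord_tvec_tangent)

end

lemma subspace_tangent_space: "subspace (tangent_space A p)"
  unfolding tangent_space_eq_range[OF chart_at]
  by (rule linear_subspace_image[OF linear_coord_tvec[OF chart_at] subspace_UNIV])

text \<open>This map gives the coordinates in \<open>c'\<close> of the field
  \<open>coord_tvec A c q e\<close>. The Jacobian is taken at the \<open>c\<close>-coordinates of
  the moving point, hence the composition with \<open>transition c' c\<close>.\<close>

lemma smooth_on_jac_pullback: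
  assumes "c \<in> A" "c' \<in> A"
  shows "smooth_on (snd c' ` (dom_of c' \<inter> dom_of c)) (\<lambda>x. jac c c' (transition c' c x) e)"
  unfolding jac_def
  by (rule smooth_on_compose[OF _ _ _ smooth_transition smooth_on_frechet[OF smooth_transition]])
    (use assms in \<open>auto simp: open_chart_image open_dom transition_chart\<close>)

lemma smooth_coord_field:
  assumes "c \<in> A"
  shows "smooth_field_on A (dom_of c) (\<lambda>q. coord_tvec A c q e)"
  unfolding smooth_field_on_def
proof (intro conjI ballI)
  fix c' assume c': "c' \<in> A"
  have "open (snd c' ` (dom_of c' \<inter> dom_of c))" using assms c' by (simp add: open_chart_image open_dom)
  then show "smooth_on (snd c' ` (dom_of c' \<inter> dom_of c)) (field_rep c' (\<lambda>q. coord_tvec A c q e))"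
    by (rule smooth_on_cong[OF _ _ smooth_on_jac_pullback[OF assms c']])
      (use assms c' in \<open>auto simp: field_rep_def inv_chart coord_tvec_eq transition_chart\<close>)
qed (use assms in auto)

section \<open>Extension of tangent vectors to vector fields\<close>

text \<open>The field with constant coordinates in one chart is multiplied by a bump function that
  vanishes off a closed coordinate ball, then extended by 0.\<close>

lemma tangent_extension:
  assumes v: "v \<in> tangent_space A p"
  shows "\<exists>X. smooth_field_on A UNIV X \<and> X p = v"
proof -
  define c where "c = chart_at A p"
  have c: "c \<in> A" "p \<in> dom_of c" using chart_at by (auto simp: c_def)
  have "snd c p \<in> img_of c" using c(2) by (rule imageI)
  with open_img[OF c(1)] obtain R where R: "R > 0" "cball (snd c p) R \<subseteq> img_of c"
    unfolding open_contains_cball by blast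
  define \<rho> where "\<rho> = bump (snd c p) R"
  define K where "K = inv_of c ` cball (snd c p) R"
  have "continuous_on (cball (snd c p) R) (inv_of c)"
    by (rule continuous_on_subset[OF homeomorphism_cont2[OF homeomorphism_chart[OF c(1)]] R(2)])
  \<comment> \<open>A compact set is closed because the manifold is Hausdorff; this makes
    \<open>- K\<close> open, so that smoothness can be checked there.\<close>
  then have "closed K"
    unfolding K_def by (rule compact_imp_closed[OF compact_continuous_image[OF _ compact_cball]])
  have K: "\<rho> (snd c q) = 0" if "q \<in> dom_of c" "q \<notin> K" for q
  proof -
    have "inv_of c (snd c q) \<notin> K" using that inv_chart[OF c(1)] by simp
    then have "snd c q \<notin> cball (snd c p) R" unfolding K_def by blast
    then have "snd c q \<notin> ball (snd c p) R" by simp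
    then show ?thesis using R(1) by (simp add: \<rho>_def bump_eq_0)
  qed
  have K_dom: "K \<subseteq> dom_of c" using R(2) inv_chart[OF c(1)] by (auto simp: K_def)
  \<comment> \<open>Dividing by the value of the bump at the centre makes the field equal to
    \<open>v\<close> at \<open>p\<close>.\<close>
  define e where "e = (1 / \<rho> (snd c p)) *\<^sub>R v c"
  define X where "X q = (if q \<in> dom_of c then \<rho> (snd c q) *\<^sub>R coord_tvec A c q e else 0)" for q
  have "X p = coord_tvec A c p (v c)"
    using c bump_center[OF R(1), of "snd c p"]
    by (simp add: X_def e_def \<rho>_def linear_scale[OF linear_coord_tvec])
  then have "X p = v" using coord_tvec_tangent[OF c v] by simp
  moreover have "smooth_field_on A UNIV X"
    unfolding smooth_field_on_def
  proof (intro conjI ballI)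
    fix q show "X q \<in> tangent_space A q"
      using c subspace_tangent_space[of q] by (auto simp: X_def subspace_scale subspace_0)
  next
    fix c' assume c': "c' \<in> A"
    \<comment> \<open>As \<open>K\<close> lies in the domain of \<open>c\<close>, these two open
      sets cover the image of \<open>c'\<close>. On the first the field is given by its formula, on
      the second it is 0.\<close>
    let ?S = "snd c' ` (dom_of c' \<inter> dom_of c)" and ?T = "snd c' ` (dom_of c' \<inter> - K)"
    have S: "open ?S" "open ?T"
      using c c' \<open>closed K\<close> by (auto intro!: open_chart_image open_dom)
    have "smooth_on ?S (\<lambda>x. \<rho> (transition c' c x))"
      unfolding \<rho>_def
      by (rule smooth_on_compose[OF S(1) open_UNIV _ smooth_transition smooth_on_bump]) (use c c' in auto)
    moreover have "smooth_on ?S (field_rep c' (\<lambda>q. coord_tvec A c q e))"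
      using smooth_coord_field[OF c(1)] c' unfolding smooth_field_on_def by blast
    ultimately have "smooth_on ?S (\<lambda>x. \<rho> (transition c' c x) *\<^sub>R field_rep c' (\<lambda>q. coord_tvec A c q e) x)"
      by (rule smooth_on_scaleR[OF S(1)])
    then have "smooth_on ?S (field_rep c' X)"
      by (rule smooth_on_cong[OF S(1), rotated])
        (use c' in \<open>auto simp: field_rep_def inv_chart transition_chart X_def scaleR_fun_def\<close>)
    moreover have "smooth_on ?T (field_rep c' X)"
      by (rule smooth_on_cong[OF S(2) _ smooth_on_const[of _ 0]])
        (use c' K in \<open>auto simp: field_rep_def inv_chart X_def\<close>)
    ultimately have "smooth_on (?S \<union> ?T) (field_rep c' X)" by (rule smooth_on_Un[OF S])
    moreover have "?S \<union> ?T = snd c' ` (dom_of c' \<inter> UNIV)" using K_dom by auto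
    ultimately show "smooth_on (snd c' ` (dom_of c' \<inter> UNIV)) (field_rep c' X)" by simp
  qed
  ultimately show ?thesis by blast
qed

section \<open>The Lie bracket\<close>

text \<open>\<open>lie_bracket\<close> computes at each point in a chart chosen for that point.
  Smoothness needs the same formula throughout one fixed chart.\<close>

definition bracket_rep :: "('m, 'e) chart \<Rightarrow> ('m \<Rightarrow> ('m, 'e) tvec) \<Rightarrow> ('m \<Rightarrow> ('m, 'e) tvec) \<Rightarrow> 'e \<Rightarrow> 'e" where
  "bracket_rep c X Y x = frechet_derivative (field_rep c Y) (at x) (field_rep c X x) -
    frechet_derivative (field_rep c X) (at x) (field_rep c Y x)"

lemma field_rep_chart: "c \<in> A \<Longrightarrow> p \<in> dom_of c \<Longrightarrow> field_rep c X (snd c p) = X p c"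
  by (simp add: field_rep_def inv_chart)

lemma lie_bracket_eq:
  "lie_bracket A X Y p = coord_tvec A (chart_at A p) p (bracket_rep (chart_at A p) X Y (snd (chart_at A p) p))"
  by (simp add: lie_bracket_def bracket_rep_def Let_def field_rep_chart chart_at)

lemma smooth_field_rep:
  "smooth_field_on A UNIV X \<Longrightarrow> c \<in> A \<Longrightarrow> smooth_on (img_of c) (field_rep c X)"
  by (auto simp: smooth_field_on_def)

lemma smooth_field_tangent: "smooth_field_on A UNIV X \<Longrightarrow> X p \<in> tangent_space A p"
  by (simp add: smooth_field_on_def)

text \<open>The identity \<open>field_rep c' X (transition c c' x) = jac c c' x (field_rep c X
  x)\<close> is differentiated on both sides, by the chain rule and by the product rule. The first
  summand contains the second derivative of the transition map.\<close>

lemma frechet_field_rep_transition: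
  assumes X: "smooth_field_on A UNIV X"
    and c: "c \<in> A" "c' \<in> A" "p \<in> dom_of c" "p \<in> dom_of c'"
  shows "frechet_derivative (field_rep c' X) (at (snd c' p)) (jac c c' (snd c p) a) =
    frechet_derivative (\<lambda>x. jac c c' x (X p c)) (at (snd c p)) a +
    jac c c' (snd c p) (frechet_derivative (field_rep c X) (at (snd c p)) a)"
proof -
  let ?S = "snd c ` (dom_of c \<inter> dom_of c')" and ?x = "snd c p"
  have S: "open ?S" "?x \<in> ?S" using c by (auto intro!: open_chart_image open_dom)
  have img: "snd d p \<in> img_of d" if "d \<in> {c, c'}" for d using c that by auto
  have dX: "(field_rep c X has_derivative frechet_derivative (field_rep c X) (at ?x)) (at ?x)"
    by (rule smooth_on_has_derivative[OF smooth_field_rep[OF X c(1)] img]) simp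
  have dX': "(field_rep c' X has_derivative frechet_derivative (field_rep c' X) (at (snd c' p))) (at (transition c c' ?x))"
    using smooth_on_has_derivative[OF smooth_field_rep[OF X c(2)] img] c by (simp add: transition_chart)
  have lhs: "((\<lambda>x. field_rep c' X (transition c c' x)) has_derivative
      (\<lambda>a. frechet_derivative (field_rep c' X) (at (snd c' p)) (jac c c' ?x a))) (at ?x)"
    by (rule has_derivative_compose[OF has_derivative_transition[OF c] dX'])
  have dJ: "((\<lambda>x. jac c c' x b) has_derivative frechet_derivative (\<lambda>x. jac c c' x b) (at ?x)) (at ?x)" for b
    unfolding jac_def by (rule smooth_on_has_derivative[OF smooth_on_frechet[OF smooth_transition] S(2)]) (use c in auto)
  \<comment> \<open>The Jacobian applied to a moving vector becomes a sum of products, each open to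
    the product rule.\<close>
  have expand: "jac c c' x u = (\<Sum>b\<in>B. (u \<bullet> b) *\<^sub>R jac c c' x b)" if x: "x \<in> ?S" for x u
  proof -
    obtain q where q: "x = snd c q" "q \<in> dom_of c" "q \<in> dom_of c'" using x by blast
    show ?thesis unfolding q(1) by (rule linear_expansion[OF linear_jac[OF c(1,2) q(2,3)]])
  qed
  have "((\<lambda>x. \<Sum>b\<in>B. (X p c \<bullet> b) *\<^sub>R jac c c' x b) has_derivative
      (\<lambda>a. \<Sum>b\<in>B. (X p c \<bullet> b) *\<^sub>R frechet_derivative (\<lambda>x. jac c c' x b) (at ?x) a)) (at ?x)"
    by (intro has_derivative_sum has_derivative_scaleR_right dJ)
  then have "((\<lambda>x. jac c c' x (X p c)) has_derivative
      (\<lambda>a. \<Sum>b\<in>B. (X p c \<bullet> b) *\<^sub>R frechet_derivative (\<lambda>x. jac c c' x b) (at ?x) a)) (at ?x)"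
    by (rule has_derivative_transform_within_open[OF _ S]) (rule expand[symmetric])
  \<comment> \<open>The derivative of the Jacobian alone, with its argument held at
    \<open>X p c\<close>.\<close>
  note frozen = frechet_derivative_at[OF this, symmetric]
  have "((\<lambda>x. \<Sum>b\<in>B. (field_rep c X x \<bullet> b) *\<^sub>R jac c c' x b) has_derivative
      (\<lambda>a. \<Sum>b\<in>B. (field_rep c X ?x \<bullet> b) *\<^sub>R frechet_derivative (\<lambda>x. jac c c' x b) (at ?x) a +
        (frechet_derivative (field_rep c X) (at ?x) a \<bullet> b) *\<^sub>R jac c c' ?x b)) (at ?x)"
    by (intro has_derivative_sum has_derivative_scaleR has_derivative_inner_left dX dJ)
  then have "((\<lambda>x. field_rep c' X (transition c c' x)) has_derivative
      (\<lambda>a. \<Sum>b\<in>B. (field_rep c X ?x \<bullet> b) *\<^sub>R frechet_derivative (\<lambda>x. jac c c' x b) (at ?x) a +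
        (frechet_derivative (field_rep c X) (at ?x) a \<bullet> b) *\<^sub>R jac c c' ?x b)) (at ?x)"
  proof (rule has_derivative_transform_within_open[OF _ S])
    fix x assume x: "x \<in> ?S"
    then obtain q where q: "x = snd c q" "q \<in> dom_of c" "q \<in> dom_of c'" by blast
    show "(\<Sum>b\<in>B. (field_rep c X x \<bullet> b) *\<^sub>R jac c c' x b) = field_rep c' X (transition c c' x)"
      unfolding expand[OF x, symmetric]
      using q c tangent_jac[OF smooth_field_tangent[OF X]] by (simp add: transition_chart field_rep_chart)
  qed
  from fun_cong[OF has_derivative_unique[OF lhs this], of a]
  show ?thesis
    using c by (simp add: frozen field_rep_chart sum.distrib
        expand[OF S(2), of "frechet_derivative (field_rep c X) (at ?x) a"])
qed

text \<open>The second derivatives of the transition map enter once from each field and cancel in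
  the difference by symmetry; what remains transforms by the Jacobian.\<close>

lemma bracket_rep_transition:
  assumes X: "smooth_field_on A UNIV X" and Y: "smooth_field_on A UNIV Y"
    and c: "c \<in> A" "c' \<in> A" "p \<in> dom_of c" "p \<in> dom_of c'"
  shows "bracket_rep c' X Y (snd c' p) = jac c c' (snd c p) (bracket_rep c X Y (snd c p))"
proof -
  let ?S = "snd c ` (dom_of c \<inter> dom_of c')"
  have S: "open ?S" "snd c p \<in> ?S" using c by (auto intro!: open_chart_image open_dom)
  have sym: "frechet_derivative (\<lambda>x. jac c c' x a) (at (snd c p)) b =
      frechet_derivative (\<lambda>x. jac c c' x b) (at (snd c p)) a" for a b
    unfolding jac_def by (rule second_derivative_symmetric[OF smooth_transition S]) (use c in auto)
  have "X p c' = jac c c' (snd c p) (X p c)" "Y p c' = jac c c' (snd c p) (Y p c)"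
    using tangent_jac[OF smooth_field_tangent[OF X] c] tangent_jac[OF smooth_field_tangent[OF Y] c] by simp_all
  then show ?thesis
    using c sym[of "Y p c" "X p c"]
    by (simp add: bracket_rep_def field_rep_chart frechet_field_rep_transition X Y linear_diff[OF linear_jac])
qed

lemma lie_bracket_chart:
  assumes "smooth_field_on A UNIV X" "smooth_field_on A UNIV Y" "c \<in> A" "p \<in> dom_of c"
  shows "lie_bracket A X Y p c = bracket_rep c X Y (snd c p)"
  using assms by (simp add: lie_bracket_eq coord_tvec_eq bracket_rep_transition[OF assms(1,2) chart_at(1) _ chart_at(2)])

lemma lie_bracket_tangent: "lie_bracket A X Y p \<in> tangent_space A p"
  using chart_at by (simp add: lie_bracket_eq)

lemma smooth_lie_bracket:
  assumes X: "smooth_field_on A UNIV X" and Y: "smooth_field_on A UNIV Y"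
  shows "smooth_field_on A UNIV (lie_bracket A X Y)"
  unfolding smooth_field_on_def
proof (intro conjI ballI)
  fix c assume c: "c \<in> A"
  have o: "open (img_of c)" by (rule open_img[OF c])
  have "smooth_on (img_of c) (bracket_rep c X Y)"
    unfolding bracket_rep_def
    by (intro smooth_on_diff smooth_on_frechet_apply o smooth_field_rep X Y c)
  then have "smooth_on (img_of c) (field_rep c (lie_bracket A X Y))"
    by (rule smooth_on_cong[OF o, rotated]) (use c X Y in \<open>auto simp: field_rep_chart lie_bracket_chart\<close>)
  then show "smooth_on (snd c ` (dom_of c \<inter> UNIV)) (field_rep c (lie_bracket A X Y))" by simp
qed (rule lie_bracket_tangent)

section \<open>Alternating forms\<close>

lemma alt_outside:
  "\<alpha> \<in> alt_forms A k p \<Longrightarrow> \<not> (length vs = k \<and> set vs \<subseteq> tangent_space A p) \<Longrightarrow> \<alpha> vs = 0"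
  unfolding alt_forms_def by blast

lemma alt_not_distinct: "\<alpha> \<in> alt_forms A k p \<Longrightarrow> \<not> distinct vs \<Longrightarrow> \<alpha> vs = 0"
  unfolding alt_forms_def by blast

text \<open>As forms vanish on lists of the wrong length, the next laws hold for lists of any length.\<close>

lemma alt_add:
  assumes \<alpha>: "\<alpha> \<in> alt_forms A k p" and v: "v \<in> tangent_space A p" "w \<in> tangent_space A p"
  shows "\<alpha> (us @ (v + w) # ws) = \<alpha> (us @ v # ws) + \<alpha> (us @ w # ws)"
proof (cases "length us + 1 + length ws = k \<and> set us \<union> set ws \<subseteq> tangent_space A p")
  case True
  with \<alpha> v show ?thesis unfolding alt_forms_def by blast
next
  case False
  then have "\<alpha> (us @ z # ws) = 0" for z by (intro alt_outside[OF \<alpha>]) auto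
  then show ?thesis by simp
qed

lemma alt_scale:
  assumes \<alpha>: "\<alpha> \<in> alt_forms A k p" and v: "v \<in> tangent_space A p"
  shows "\<alpha> (us @ (a *\<^sub>R v) # ws) = a * \<alpha> (us @ v # ws)"
proof (cases "length us + 1 + length ws = k \<and> set us \<union> set ws \<subseteq> tangent_space A p")
  case True
  with \<alpha> v show ?thesis unfolding alt_forms_def by blast
next
  case False
  then have "\<alpha> (us @ z # ws) = 0" for z by (intro alt_outside[OF \<alpha>]) auto
  then show ?thesis by simp
qed

text \<open>Polarisation: a form vanishes on lists with a repeated entry, so expanding it with
  \<open>v + w\<close> in both slots leaves the two mixed terms. If \<open>v\<close> or
  \<open>w\<close> is not tangent, both sides are 0 by normalisation.\<close>

lemma alt_swap:
  assumes \<alpha>: "\<alpha> \<in> alt_forms A k p"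
  shows "\<alpha> (us @ v # w # ws) = - \<alpha> (us @ w # v # ws)"
proof (cases "v \<in> tangent_space A p \<and> w \<in> tangent_space A p")
  case True
  then have vw: "v \<in> tangent_space A p" "w \<in> tangent_space A p" "v + w \<in> tangent_space A p"
    using subspace_add[OF subspace_tangent_space] by auto
  have diag: "\<alpha> (us @ z # z # ws) = 0" for z by (rule alt_not_distinct[OF \<alpha>]) simp
  have expand: "\<alpha> (us @ z # (v + w) # ws) = \<alpha> (us @ z # v # ws) + \<alpha> (us @ z # w # ws)" for z
    using alt_add[OF \<alpha> vw(1,2), of "us @ [z]" ws] by simp
  have "0 = \<alpha> (us @ v # (v + w) # ws) + \<alpha> (us @ w # (v + w) # ws)"
    using alt_add[OF \<alpha> vw(1,2), of us "(v + w) # ws"] by (simp only: diag)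
  then show ?thesis by (simp add: expand diag)
next
  case False
  then have "\<alpha> (us @ v # w # ws) = 0" "\<alpha> (us @ w # v # ws) = 0"
    by (auto intro: alt_outside[OF \<alpha>])
  then show ?thesis by simp
qed

text \<open>Each entry of \<open>us\<close> that \<open>z\<close> passes costs one transposition.
  The prefix \<open>ps\<close> is arbitrary because the induction moves the head of
  \<open>us\<close> into it.\<close>

lemma alt_move:
  assumes \<alpha>: "\<alpha> \<in> alt_forms A k p"
  shows "\<alpha> (ps @ us @ z # ws) = (- 1) ^ length us * \<alpha> (ps @ z # us @ ws)"
proof (induction us arbitrary: ps)
  case (Cons u us)
  have "\<alpha> (ps @ (u # us) @ z # ws) = (- 1) ^ length us * \<alpha> (ps @ u # z # us @ ws)"
    using Cons.IH[of "ps @ [u]"] by simp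
  also have "\<alpha> (ps @ u # z # us @ ws) = - \<alpha> (ps @ z # u # us @ ws)" by (rule alt_swap[OF \<alpha>])
  finally show ?case by simp
qed simp

lemma linear_alt_slot:
  assumes \<alpha>: "\<alpha> \<in> alt_forms A k p" and c: "c \<in> A" "p \<in> dom_of c"
  shows "linear (\<lambda>e. \<alpha> (us @ coord_tvec A c p e # ws))"
  by (rule linearI)
    (simp_all add: linear_add[OF linear_coord_tvec[OF c]] linear_scale[OF linear_coord_tvec[OF c]]
      alt_add[OF \<alpha>] alt_scale[OF \<alpha>] c)

lemma contract_alt_form:
  assumes \<alpha>: "\<alpha> \<in> alt_forms A (Suc k) p" and X: "X \<in> tangent_space A p"
  shows "contract X \<alpha> \<in> alt_forms A k p"
proof -
  have "\<alpha> (X # vs) = 0" if "\<not> (length vs = k \<and> set vs \<subseteq> tangent_space A p)" for vs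
    using that by (intro alt_outside[OF \<alpha>]) auto
  moreover have "\<alpha> (X # vs) = 0" if "\<not> distinct vs" for vs
    using that by (intro alt_not_distinct[OF \<alpha>]) auto
  ultimately show ?thesis
    using alt_add[OF \<alpha>, of _ _ "X # us" for us] alt_scale[OF \<alpha>, of _ "X # us" for us]
    unfolding alt_forms_def contract_def by simp
qed

lemma contract_add:
  "\<alpha> \<in> alt_forms A k p \<Longrightarrow> v \<in> tangent_space A p \<Longrightarrow> w \<in> tangent_space A p \<Longrightarrow>
    contract (v + w) \<alpha> = contract v \<alpha> + contract w \<alpha>"
  using alt_add[of \<alpha> k p v w "[]"] by (auto simp: contract_def)

lemma contract_scale:
  "\<alpha> \<in> alt_forms A k p \<Longrightarrow> v \<in> tangent_space A p \<Longrightarrow> contract (a *\<^sub>R v) \<alpha> = a *\<^sub>R contract v \<alpha>"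
  using alt_scale[of \<alpha> k p v "[]"] by (auto simp: contract_def scaleR_fun_def)

section \<open>Coordinate representations of forms\<close>

lemma form_rep_chart:
  "c \<in> A \<Longrightarrow> p \<in> dom_of c \<Longrightarrow> form_rep A c \<eta> (snd c p) es = \<eta> p (map (coord_tvec A c p) es)"
  by (simp add: form_rep_def inv_chart)

lemma smooth_form_alt: "smooth_form_on A k U \<eta> \<Longrightarrow> p \<in> U \<Longrightarrow> \<eta> p \<in> alt_forms A k p"
  by (simp add: smooth_form_on_def)

lemma linear_form_rep:
  assumes "\<eta> p \<in> alt_forms A k p" "c \<in> A" "p \<in> dom_of c"
  shows "linear (\<lambda>e. form_rep A c \<eta> (snd c p) (us @ e # ws))"
  using linear_alt_slot[OF assms, of "map (coord_tvec A c p) us" "map (coord_tvec A c p) ws"] assms(2,3)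
  by (simp add: form_rep_chart)

lemma linear_form_rep_head:
  assumes "\<eta> p \<in> alt_forms A k p" "c \<in> A" "p \<in> dom_of c"
  shows "linear (\<lambda>e. form_rep A c \<eta> (snd c p) (e # ws))"
  using linear_form_rep[where us = "[]" and \<eta> = \<eta>, OF assms] by simp

text \<open>Translates between the two conventions: the Lie derivative replaces the entry in slot
  \<open>i\<close>, while the exterior derivative deletes it and carries the sign
  \<open>(- 1) ^ i\<close>.\<close>

lemma form_rep_update:
  assumes \<eta>: "\<eta> p \<in> alt_forms A k p" and c: "c \<in> A" "p \<in> dom_of c" and i: "i < length es"
  shows "form_rep A c \<eta> (snd c p) (v # es[i := z]) =
    (- 1) ^ i * form_rep A c \<eta> (snd c p) (v # z # take i es @ drop (Suc i) es)"
  using alt_move[OF \<eta>, of "[coord_tvec A c p v]" "map (coord_tvec A c p) (take i es)"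
      "coord_tvec A c p z" "map (coord_tvec A c p) (drop (Suc i) es)"] c i
  by (simp add: form_rep_chart upd_conv_take_nth_drop)

lemma form_rep_swap:
  assumes \<eta>: "\<eta> p \<in> alt_forms A k p" and c: "c \<in> A" "p \<in> dom_of c"
  shows "form_rep A c \<eta> (snd c p) (v # w # es) = - form_rep A c \<eta> (snd c p) (w # v # es)"
  using alt_swap[OF \<eta>, of "[]" "coord_tvec A c p v" "coord_tvec A c p w" "map (coord_tvec A c p) es"] c by (simp add: form_rep_chart)

lemma form_rep_contract:
  assumes "c \<in> A" "p \<in> dom_of c" "X p \<in> tangent_space A p"
  shows "form_rep A c (\<lambda>q. contract (X q) (\<eta> q)) (snd c p) es = form_rep A c \<eta> (snd c p) (X p c # es)"
  using assms by (simp add: form_rep_chart contract_def coord_tvec_tangent)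

text \<open>Exhibits the coordinates of a contraction as a finite sum of products of coordinate
  functions; smoothness and the product rule for contractions both start from it.\<close>

lemma form_rep_contract_expand:
  assumes "c \<in> A" "p \<in> dom_of c" "X p \<in> tangent_space A p" "\<eta> p \<in> alt_forms A k p"
  shows "form_rep A c (\<lambda>q. contract (X q) (\<eta> q)) (snd c p) es =
    (\<Sum>b\<in>B. (field_rep c X (snd c p) \<bullet> b) *\<^sub>R form_rep A c \<eta> (snd c p) (b # es))"
  using linear_expansion[OF linear_form_rep_head[where \<eta> = \<eta>, OF assms(4,1,2)], of "X p c" es] assms(1-3)
  by (simp add: form_rep_contract field_rep_chart)

lemma smooth_contract:
  assumes X: "smooth_field_on A U X" and \<eta>: "smooth_form_on A (Suc k) U \<eta>" and U: "open U"
  shows "smooth_form_on A k U (\<lambda>q. contract (X q) (\<eta> q))"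
  unfolding smooth_form_on_def
proof (intro conjI ballI allI)
  fix q assume "q \<in> U"
  then show "contract (X q) (\<eta> q) \<in> alt_forms A k q"
    using X \<eta> by (auto intro!: contract_alt_form simp: smooth_field_on_def smooth_form_on_def)
next
  fix c es assume c: "c \<in> A"
  let ?S = "snd c ` (dom_of c \<inter> U)"
  have S: "open ?S" by (rule open_chart_image[OF c U])
  have "smooth_on ?S (\<lambda>x. \<Sum>b\<in>B. (field_rep c X x \<bullet> b) *\<^sub>R form_rep A c \<eta> x (b # es))"
    using X \<eta> c unfolding smooth_field_on_def smooth_form_on_def
    by (intro smooth_on_sum[OF S] smooth_on_scaleR[OF S] smooth_on_inner[OF S _ smooth_on_const]) blast+
  then show "smooth_on ?S (\<lambda>x. form_rep A c (\<lambda>q. contract (X q) (\<eta> q)) x es)"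
  proof (rule smooth_on_cong[OF S, rotated])
    fix x assume "x \<in> ?S"
    then obtain q where q: "x = snd c q" "q \<in> dom_of c" "q \<in> U" by blast
    have "X q \<in> tangent_space A q" "\<eta> q \<in> alt_forms A (Suc k) q"
      using X \<eta> q(3) unfolding smooth_field_on_def smooth_form_on_def by blast+
    from form_rep_contract_expand[where X = X and \<eta> = \<eta>, OF c q(2) this]
    show "(\<Sum>b\<in>B. (field_rep c X x \<bullet> b) *\<^sub>R form_rep A c \<eta> x (b # es)) =
        form_rep A c (\<lambda>q. contract (X q) (\<eta> q)) x es"
      unfolding q(1) by (rule sym)
  qed
qed

text \<open>Product rule for a contraction: one term differentiates the form with the field held at
  its value at \<open>p\<close>, the other differentiates the field.\<close>

lemma frechet_form_rep_contract:
  assumes X: "smooth_field_on A UNIV X" and \<eta>: "smooth_form_on A k UNIV \<eta>"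
    and c: "c \<in> A" "p \<in> dom_of c"
  shows "frechet_derivative (\<lambda>x. form_rep A c (\<lambda>q. contract (X q) (\<eta> q)) x es) (at (snd c p)) a =
    frechet_derivative (\<lambda>x. form_rep A c \<eta> x (X p c # es)) (at (snd c p)) a +
    form_rep A c \<eta> (snd c p) (frechet_derivative (field_rep c X) (at (snd c p)) a # es)"
proof -
  let ?x = "snd c p" and ?D = "\<lambda>b. frechet_derivative (\<lambda>x. form_rep A c \<eta> x (b # es)) (at (snd c p))"
  have S: "open (img_of c)" "?x \<in> img_of c" using open_img c by auto
  have \<eta>': "\<eta> q \<in> alt_forms A k q" for q by (rule smooth_form_alt[OF \<eta> UNIV_I])
  have X': "X q \<in> tangent_space A q" for q by (rule smooth_field_tangent[OF X])
  have dX: "(field_rep c X has_derivative frechet_derivative (field_rep c X) (at ?x)) (at ?x)"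
    by (rule smooth_on_has_derivative[OF smooth_field_rep[OF X c(1)] S(2)])
  have d\<eta>: "((\<lambda>x. form_rep A c \<eta> x (b # es)) has_derivative ?D b) (at ?x)" for b
  proof (rule smooth_on_has_derivative[OF _ S(2)])
    have "\<forall>c\<in>A. \<forall>es. smooth_on (snd c ` (dom_of c \<inter> UNIV)) (\<lambda>x. form_rep A c \<eta> x es)"
      using \<eta> unfolding smooth_form_on_def by blast
    then show "smooth_on (img_of c) (\<lambda>x. form_rep A c \<eta> x (b # es))" using c(1) by simp
  qed
  have expand: "form_rep A c \<eta> x (u # es) = (\<Sum>b\<in>B. (u \<bullet> b) *\<^sub>R form_rep A c \<eta> x (b # es))"
    if x: "x \<in> img_of c" for x u
  proof -
    obtain q where q: "x = snd c q" "q \<in> dom_of c" using x by blast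
    show ?thesis unfolding q(1) by (rule linear_expansion[OF linear_form_rep_head[where \<eta> = \<eta>, OF \<eta>' c(1) q(2)]])
  qed
  have "((\<lambda>x. \<Sum>b\<in>B. (X p c \<bullet> b) *\<^sub>R form_rep A c \<eta> x (b # es)) has_derivative
      (\<lambda>a. \<Sum>b\<in>B. (X p c \<bullet> b) *\<^sub>R ?D b a)) (at ?x)"
    by (intro has_derivative_sum has_derivative_scaleR_right d\<eta>)
  then have "((\<lambda>x. form_rep A c \<eta> x (X p c # es)) has_derivative
      (\<lambda>a. \<Sum>b\<in>B. (X p c \<bullet> b) *\<^sub>R ?D b a)) (at ?x)"
    by (rule has_derivative_transform_within_open[OF _ S]) (rule expand[symmetric])
  note frozen = frechet_derivative_at[OF this, symmetric]
  have "((\<lambda>x. \<Sum>b\<in>B. (field_rep c X x \<bullet> b) *\<^sub>R form_rep A c \<eta> x (b # es)) has_derivative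
      (\<lambda>a. \<Sum>b\<in>B. (field_rep c X ?x \<bullet> b) *\<^sub>R ?D b a +
        (frechet_derivative (field_rep c X) (at ?x) a \<bullet> b) *\<^sub>R form_rep A c \<eta> ?x (b # es))) (at ?x)"
    by (intro has_derivative_sum has_derivative_scaleR has_derivative_inner_left dX d\<eta>)
  then have "((\<lambda>x. form_rep A c (\<lambda>q. contract (X q) (\<eta> q)) x es) has_derivative
      (\<lambda>a. \<Sum>b\<in>B. (field_rep c X ?x \<bullet> b) *\<^sub>R ?D b a +
        (frechet_derivative (field_rep c X) (at ?x) a \<bullet> b) *\<^sub>R form_rep A c \<eta> ?x (b # es))) (at ?x)"
  proof (rule has_derivative_transform_within_open[OF _ S])
    fix x assume "x \<in> img_of c"
    then obtain q where q: "x = snd c q" "q \<in> dom_of c" by blast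
    from form_rep_contract_expand[where X = X and \<eta> = \<eta>, OF c(1) q(2) X' \<eta>']
    show "(\<Sum>b\<in>B. (field_rep c X x \<bullet> b) *\<^sub>R form_rep A c \<eta> x (b # es)) =
        form_rep A c (\<lambda>q. contract (X q) (\<eta> q)) x es"
      unfolding q(1) by (rule sym)
  qed
  from fun_cong[OF frechet_derivative_at[OF this, symmetric], of a]
  show ?thesis
    using c by (simp add: frozen field_rep_chart sum.distrib
        expand[OF S(2), of "frechet_derivative (field_rep c X) (at ?x) a"])
qed

text \<open>\<open>ext_deriv\<close> does not test the length of its argument. Deleting one entry of
  a list of wrong length leaves a list on which the form itself vanishes.\<close>

lemma ext_deriv_wrong_length:
  assumes \<eta>: "smooth_form_on A k UNIV \<eta>" and "length vs \<noteq> Suc k"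
  shows "ext_deriv A \<eta> p vs = 0"
proof -
  have "form_rep A c \<eta> x es = 0" if "length es \<noteq> k" for c x es
    unfolding form_rep_def using that by (intro alt_outside[OF smooth_form_alt[OF \<eta> UNIV_I]]) simp
  moreover have "length (take i es @ drop (Suc i) es) \<noteq> k"
    if "i < length es" "length es = length vs" for i and es :: "'e list"
    using that assms(2) by (simp add: min_def)
  ultimately have "(\<lambda>x. form_rep A c \<eta> x (take i es @ drop (Suc i) es)) = (\<lambda>_. 0)"
    if "i < length es" "length es = length vs" for c i and es :: "'e list"
    using that by blast
  then show ?thesis
    unfolding ext_deriv_def Let_def by (auto intro!: sum.neutral)
qed

section \<open>The Dorfman bracket on the graph\<close>

abbreviation graph_section :: "('m \<Rightarrow> ('m, 'e) cov) \<Rightarrow> ('m \<Rightarrow> ('m, 'e) tvec) \<Rightarrow> 'm \<Rightarrow> ('m, 'e) gvec" where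
  "graph_section \<omega> X \<equiv> (\<lambda>q. (X q, contract (X q) (\<omega> q)))"

text \<open>The terms that differentiate the fields along the arguments \<open>vs\<close> cancel by antisymmetry.\<close>

lemma dorfman_bracket_graph:
  assumes X: "smooth_field_on A UNIV X" and Y: "smooth_field_on A UNIV Y"
    and \<omega>: "smooth_form_on A (Suc n) UNIV \<omega>" and vs: "set vs \<subseteq> tangent_space A p"
  shows "snd (dorfman_bracket A (graph_section \<omega> X) (graph_section \<omega> Y) p) vs =
    \<omega> p (lie_bracket A X Y p # vs) + ext_deriv A \<omega> p (X p # Y p # vs)"
proof -
  define c where "c = chart_at A p"
  have c: "c \<in> A" "p \<in> dom_of c" unfolding c_def by (rule chart_at)+
  define es where "es = map (\<lambda>v. v c) vs"
  define W where "W = form_rep A c \<omega> (snd c p)"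
  define dW where "dW l a = frechet_derivative (\<lambda>x. form_rep A c \<omega> x l) (at (snd c p)) a" for l a
  define DX where "DX = frechet_derivative (field_rep c X) (at (snd c p))"
  define DY where "DY = frechet_derivative (field_rep c Y) (at (snd c p))"
  define u where "u = X p c"
  define v where "v = Y p c"
  define \<alpha> where "\<alpha> = (\<lambda>q. contract (X q) (\<omega> q))"
  define \<beta> where "\<beta> = (\<lambda>q. contract (Y q) (\<omega> q))"
  let ?del = "\<lambda>i. take i es @ drop (Suc i) es"
  have \<omega>p: "\<omega> p \<in> alt_forms A (Suc n) p" by (rule smooth_form_alt[OF \<omega> UNIV_I])
  have Xp: "X p \<in> tangent_space A p" and Yp: "Y p \<in> tangent_space A p"
    using X Y by (auto intro: smooth_field_tangent)
  have \<alpha>: "smooth_form_on A n UNIV \<alpha>" unfolding \<alpha>_def by (rule smooth_contract[OF X \<omega> open_UNIV])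
  have rep: "form_rep A c \<alpha> (snd c p) l = W (u # l)" "form_rep A c \<beta> (snd c p) l = W (v # l)" for l
    using form_rep_contract[OF c, of X \<omega>] form_rep_contract[OF c, of Y \<omega>] Xp Yp
    by (simp_all add: \<alpha>_def \<beta>_def W_def u_def v_def)
  have d\<alpha>: "frechet_derivative (\<lambda>x. form_rep A c \<alpha> x l) (at (snd c p)) a = dW (u # l) a + W (DX a # l)" for l a
    unfolding \<alpha>_def W_def dW_def DX_def u_def by (rule frechet_form_rep_contract[OF X \<omega> c])
  have d\<beta>: "frechet_derivative (\<lambda>x. form_rep A c \<beta> x l) (at (snd c p)) a = dW (v # l) a + W (DY a # l)" for l a
    unfolding \<beta>_def W_def dW_def DY_def v_def by (rule frechet_form_rep_contract[OF Y \<omega> c])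
  \<comment> \<open>The product rule is used twice, first for the contraction with \<open>Y\<close>,
    then inside it for \<open>\<alpha>\<close>, the contraction of \<open>\<omega>\<close> with
    \<open>X\<close>.\<close>
  have d\<gamma>: "frechet_derivative (\<lambda>x. form_rep A c (\<lambda>q. contract (Y q) (\<alpha> q)) x l) (at (snd c p)) a =
      dW (u # v # l) a + W (DX a # v # l) + W (u # DY a # l)" for l a
    using frechet_form_rep_contract[OF Y \<alpha> c, of l a] by (simp add: d\<alpha> rep DY_def v_def)
  have L1: "lie_deriv A X \<beta> p vs = dW (v # es) u + W (DY u # es) +
      (\<Sum>i<length es. W (v # es[i := DX (es ! i)]))"
    by (simp only: lie_deriv_def vs if_True Let_def d\<beta> rep flip: c_def es_def u_def DX_def)
  have L2: "lie_deriv A Y \<alpha> p vs = dW (u # es) v + W (DX v # es) +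
      (\<Sum>i<length es. W (u # es[i := DY (es ! i)]))"
    by (simp only: lie_deriv_def vs if_True Let_def d\<alpha> rep flip: c_def es_def v_def DY_def)
  have E1: "ext_deriv A (\<lambda>q. contract (Y q) (\<alpha> q)) p vs =
      (\<Sum>i<length es. (- 1) ^ i * (dW (u # v # ?del i) (es ! i) +
        W (DX (es ! i) # v # ?del i) + W (u # DY (es ! i) # ?del i)))"
    by (simp only: ext_deriv_def vs if_True Let_def d\<gamma> flip: c_def es_def)
  have vs': "set (X p # Y p # vs) \<subseteq> tangent_space A p" using vs Xp Yp by simp
  have "ext_deriv A \<omega> p (X p # Y p # vs) =
      (\<Sum>i<Suc (Suc (length es)). (- 1) ^ i * dW (take i (u # v # es) @ drop (Suc i) (u # v # es)) ((u # v # es) ! i))"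
    by (simp only: ext_deriv_def vs' if_True Let_def dW_def list.map length_Cons flip: c_def es_def u_def v_def)
  \<comment> \<open>The summands 0 and 1, which differentiate along \<open>X\<close> and
    \<open>Y\<close>, are split off. The remaining indices shift by two, so their signs are
    unchanged.\<close>
  also have "\<dots> = dW (v # es) u - dW (u # es) v + (\<Sum>i<length es. (- 1) ^ i * dW (u # v # ?del i) (es ! i))"
    by (simp only: sum.lessThan_Suc_shift) simp
  finally have E2: "ext_deriv A \<omega> p (X p # Y p # vs) =
      dW (v # es) u - dW (u # es) v + (\<Sum>i<length es. (- 1) ^ i * dW (u # v # ?del i) (es ! i))" .
  have upd: "W (z # es[i := z']) = (- 1) ^ i * W (z # z' # ?del i)" if "i < length es" for i z z'
    unfolding W_def by (rule form_rep_update[where \<eta> = \<omega>, OF \<omega>p c that])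
  have swap: "W (DX (es ! i) # v # l) = - W (v # DX (es ! i) # l)" for i l
    unfolding W_def by (rule form_rep_swap[where \<eta> = \<omega>, OF \<omega>p c])
  \<comment> \<open>In this form the sum with \<open>DX\<close> cancels the one in
    \<open>L1\<close>, and the sum with \<open>DY\<close> cancels the one in \<open>L2\<close>,
    which enters the bracket negatively. The sign of the former comes from exchanging
    \<open>v\<close> with \<open>DX (es ! i)\<close>.\<close>
  have E1': "ext_deriv A (\<lambda>q. contract (Y q) (\<alpha> q)) p vs =
      (\<Sum>i<length es. (- 1) ^ i * dW (u # v # ?del i) (es ! i)) -
      (\<Sum>i<length es. W (v # es[i := DX (es ! i)])) + (\<Sum>i<length es. W (u # es[i := DY (es ! i)]))"
    unfolding E1 sum_subtractf[symmetric] sum.distrib[symmetric]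
    by (rule sum.cong) (simp_all add: upd swap algebra_simps)
  have "lie_bracket A X Y p c = DY u - DX v"
    unfolding lie_bracket_chart[OF X Y c] bracket_rep_def DX_def DY_def u_def v_def
    using c by (simp add: field_rep_chart)
  moreover have "\<omega> p (lie_bracket A X Y p # vs) = W (lie_bracket A X Y p c # es)"
    unfolding W_def es_def using c
    by (simp add: form_rep_chart coord_tvec_tangent[OF c lie_bracket_tangent] map_coord_tvec[OF c vs] del: map_map)
  moreover have "W ((DY u - DX v) # es) = W (DY u # es) - W (DX v # es)"
    unfolding W_def by (rule linear_diff[OF linear_form_rep_head[where \<eta> = \<omega>, OF \<omega>p c]])
  moreover have "snd (dorfman_bracket A (graph_section \<omega> X) (graph_section \<omega> Y) p) vs =
      lie_deriv A X \<beta> p vs - lie_deriv A Y \<alpha> p vs + ext_deriv A (\<lambda>q. contract (Y q) (\<alpha> q)) p vs"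
    by (simp add: dorfman_bracket_def Let_def comp_def \<alpha>_def \<beta>_def)
  ultimately show ?thesis by (simp add: L1 L2 E1' E2)
qed

lemma dorfman_bracket_fst:
  "fst (dorfman_bracket A (graph_section \<omega> X) (graph_section \<omega> Y) p) = lie_bracket A X Y p"
  by (simp add: dorfman_bracket_def Let_def comp_def)

text \<open>A section of the graph is determined by its vector part; conversely the form part of a
  smooth field is smooth by \<open>smooth_contract\<close>. Closure under the bracket thus becomes a
  statement about pairs of fields.\<close>

lemma sections_of_graph_iff:
  assumes "smooth_form_on A (Suc n) UNIV \<omega>"
  shows "s \<in> sections_of A n (sharp_graph A \<omega>) \<longleftrightarrow> (\<exists>X. smooth_field_on A UNIV X \<and> s = graph_section \<omega> X)"
proof
  assume s: "s \<in> sections_of A n (sharp_graph A \<omega>)"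
  then have "smooth_field_on A UNIV (fst \<circ> s)" by (simp add: sections_of_def smooth_section_on_def)
  moreover have "s q = (fst (s q), contract (fst (s q)) (\<omega> q))" for q
  proof -
    have "s q \<in> sharp_graph A \<omega> q" using s by (simp add: sections_of_def)
    then show ?thesis unfolding sharp_graph_def by force
  qed
  then have "s = graph_section \<omega> (fst \<circ> s)" unfolding comp_def by (rule ext)
  ultimately show "\<exists>X. smooth_field_on A UNIV X \<and> s = graph_section \<omega> X" by blast
next
  assume "\<exists>X. smooth_field_on A UNIV X \<and> s = graph_section \<omega> X"
  then obtain X where X: "smooth_field_on A UNIV X" "s = graph_section \<omega> X" by blast
  then show "s \<in> sections_of A n (sharp_graph A \<omega>)"
    using smooth_contract[OF X(1) assms open_UNIV] smooth_field_tangent[OF X(1)]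
    by (auto simp: sections_of_def smooth_section_on_def comp_def sharp_graph_def)
qed

lemma closed_under_dorfman_graph_iff:
  assumes \<omega>: "smooth_form_on A (Suc n) UNIV \<omega>"
  shows "closed_under_dorfman A n (sharp_graph A \<omega>) \<longleftrightarrow> closed_form A \<omega>"
proof
  assume closed: "closed_under_dorfman A n (sharp_graph A \<omega>)"
  have *: "ext_deriv A \<omega> p (v # w # vs) = 0" if vs: "set (v # w # vs) \<subseteq> tangent_space A p" for p v w vs
  proof -
    obtain X Y where X: "smooth_field_on A UNIV X" "X p = v" and Y: "smooth_field_on A UNIV Y" "Y p = w"
      using tangent_extension[of v p] tangent_extension[of w p] vs by auto
    have "graph_section \<omega> X \<in> sections_of A n (sharp_graph A \<omega>)"
      "graph_section \<omega> Y \<in> sections_of A n (sharp_graph A \<omega>)"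
      using X(1) Y(1) sections_of_graph_iff[OF \<omega>] by blast+
    then have "dorfman_bracket A (graph_section \<omega> X) (graph_section \<omega> Y) \<in> sections_of A n (sharp_graph A \<omega>)"
      using closed unfolding closed_under_dorfman_def by blast
    then have "dorfman_bracket A (graph_section \<omega> X) (graph_section \<omega> Y) p \<in> sharp_graph A \<omega> p"
      unfolding sections_of_def by blast
    then obtain Z where Z: "dorfman_bracket A (graph_section \<omega> X) (graph_section \<omega> Y) p = (Z, contract Z (\<omega> p))"
      unfolding sharp_graph_def by blast
    \<comment> \<open>The first component of the bracket leaves only this choice; comparing second
      components then isolates the term with \<open>ext_deriv\<close>.\<close>
    have "Z = lie_bracket A X Y p"
      using dorfman_bracket_fst[where X = X and Y = Y and \<omega> = \<omega> and p = p] unfolding Z by simp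
    with Z have "snd (dorfman_bracket A (graph_section \<omega> X) (graph_section \<omega> Y) p) =
        contract (lie_bracket A X Y p) (\<omega> p)"
      by simp
    then show ?thesis
      using dorfman_bracket_graph[OF X(1) Y(1) \<omega>, of vs p] vs X(2) Y(2) by (simp add: contract_def)
  qed
  show "closed_form A \<omega>"
    unfolding closed_form_def
  proof (intro allI ext)
    fix p vs
    show "ext_deriv A \<omega> p vs = 0 vs"
    \<comment> \<open>The derivative of an \<open>(n + 1)\<close>-form takes \<open>n + 2\<close>
      arguments, so there are always two leading ones to be extended to fields. On all other lists
      it is 0.\<close>
    proof (cases "length vs = Suc (Suc n) \<and> set vs \<subseteq> tangent_space A p")
      case True
      then obtain v w vs' where "vs = v # w # vs'" by (auto simp: length_Suc_conv)
      with True * show ?thesis by simp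
    next
      case False
      then have "ext_deriv A \<omega> p vs = 0"
        using ext_deriv_wrong_length[OF \<omega>, of vs p] by (cases "set vs \<subseteq> tangent_space A p") (auto simp: ext_deriv_def)
      then show ?thesis by simp
    qed
  qed
next
  assume closed: "closed_form A \<omega>"
  show "closed_under_dorfman A n (sharp_graph A \<omega>)"
    unfolding closed_under_dorfman_def
  proof (intro ballI)
    fix s t assume "s \<in> sections_of A n (sharp_graph A \<omega>)" "t \<in> sections_of A n (sharp_graph A \<omega>)"
    then obtain X Y where X: "smooth_field_on A UNIV X" "s = graph_section \<omega> X"
      and Y: "smooth_field_on A UNIV Y" "t = graph_section \<omega> Y"
      using sections_of_graph_iff[OF \<omega>] by blast
    have "snd (dorfman_bracket A s t p) vs = contract (lie_bracket A X Y p) (\<omega> p) vs" for p vs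
    proof (cases "set vs \<subseteq> tangent_space A p")
      case True
      have "ext_deriv A \<omega> p = 0" using closed by (simp add: closed_form_def)
      then show ?thesis
        using dorfman_bracket_graph[OF X(1) Y(1) \<omega> True] unfolding X(2) Y(2) by (simp add: contract_def)
    next
      \<comment> \<open>Off the tangent lists both sides are 0 by normalisation, so the equality
        holds as one of functions.\<close>
      case False
      then have "contract (lie_bracket A X Y p) (\<omega> p) vs = 0"
        unfolding contract_def by (intro alt_outside[OF smooth_form_alt[OF \<omega> UNIV_I]]) auto
      moreover have "snd (dorfman_bracket A s t p) vs = 0"
        using False by (auto simp: dorfman_bracket_def Let_def lie_deriv_def ext_deriv_def)
      ultimately show ?thesis by simp
    qed
    then have "dorfman_bracket A s t = graph_section \<omega> (lie_bracket A X Y)"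
      using dorfman_bracket_fst[where X = X and Y = Y and \<omega> = \<omega>] unfolding X(2) Y(2) by (auto simp: prod_eq_iff fun_eq_iff)
    then show "dorfman_bracket A s t \<in> sections_of A n (sharp_graph A \<omega>)"
      using smooth_lie_bracket[OF X(1) Y(1)] sections_of_graph_iff[OF \<omega>] by blast
  qed
qed

section \<open>The graph as a maximal isotropic subbundle\<close>

lemma linear_graph:
  assumes \<alpha>: "\<omega> p \<in> alt_forms A k p" and c: "c \<in> A" "p \<in> dom_of c"
  shows "linear (\<lambda>e. (coord_tvec A c p e, contract (coord_tvec A c p e) (\<omega> p)))"
  by (rule linearI)
    (simp_all add: linear_add[OF linear_coord_tvec[OF c]] linear_scale[OF linear_coord_tvec[OF c]]
      contract_add[OF \<alpha>] contract_scale[OF \<alpha>] c)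

lemma sharp_graph_eq_range:
  assumes c: "c \<in> A" "p \<in> dom_of c"
  shows "sharp_graph A \<omega> p = range (\<lambda>e. (coord_tvec A c p e, contract (coord_tvec A c p e) (\<omega> p)))"
  unfolding sharp_graph_def tangent_space_eq_range[OF c] by blast

text \<open>Over a chart domain, \<open>e\<close> is sent linearly to the point of the graph above
  the tangent vector with coordinates \<open>e\<close>. The images of the basis vectors form a
  smooth frame.\<close>

lemma smooth_subbundle_graph:
  assumes \<omega>: "smooth_form_on A (Suc n) UNIV \<omega>"
  shows "smooth_subbundle A n (sharp_graph A \<omega>)"
  unfolding smooth_subbundle_def
proof (intro conjI allI)
  fix p
  have \<omega>': "\<omega> q \<in> alt_forms A (Suc n) q" for q by (rule smooth_form_alt[OF \<omega> UNIV_I])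
  show "subspace (sharp_graph A \<omega> p)"
    unfolding sharp_graph_eq_range[OF chart_at]
    by (rule linear_subspace_image[OF linear_graph[where \<omega> = \<omega>, OF \<omega>' chart_at] subspace_UNIV])
  show "sharp_graph A \<omega> p \<subseteq> tangent_space A p \<times> alt_forms A n p"
    using contract_alt_form[OF \<omega>'[of p]] unfolding sharp_graph_def by blast
  define c where "c = chart_at A p"
  have c: "c \<in> A" "p \<in> dom_of c" unfolding c_def by (rule chart_at)+
  \<comment> \<open>Frames are indexed by natural numbers, so the basis is enumerated.\<close>
  obtain b where b: "bij_betw b {..<card B} B"
    using ex_bij_betw_nat_finite[OF finite_B] by (auto simp: atLeast0LessThan)
  define E where "E q e = (coord_tvec A c q e, contract (coord_tvec A c q e) (\<omega> q))" for q e
  have smooth_frame: "smooth_section_on A n (dom_of c) (\<lambda>q. E q e)" for e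
  proof -
    have "smooth_form_on A (Suc n) (dom_of c) \<omega>"
      using \<omega> unfolding smooth_form_on_def by (blast intro: smooth_on_subset)
    from smooth_contract[OF smooth_coord_field[OF c(1)] this open_dom[OF c(1)]] smooth_coord_field[OF c(1)]
    show ?thesis by (simp add: smooth_section_on_def comp_def E_def)
  qed
  have frame: "inj_on (\<lambda>i. E q (b i)) {..<card B} \<and> independent ((\<lambda>i. E q (b i)) ` {..<card B}) \<and>
      span ((\<lambda>i. E q (b i)) ` {..<card B}) = sharp_graph A \<omega> q" if q: "q \<in> dom_of c" for q
  proof -
    have lin: "linear (E q)" unfolding E_def[abs_def] by (rule linear_graph[where \<omega> = \<omega>, OF \<omega>' c(1) q])
    \<comment> \<open>The vector component, read in the chart \<open>c\<close>, recovers
      \<open>e\<close>.\<close>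
    have inj: "inj (E q)"
    proof (rule injI)
      fix e e' assume "E q e = E q e'"
      then have "coord_tvec A c q e c = coord_tvec A c q e' c" by (simp add: E_def)
      then show "e = e'" using c(1) q by simp
    qed
    have img: "(\<lambda>i. E q (b i)) ` {..<card B} = E q ` B"
      using bij_betw_imp_surj_on[OF b] by (simp add: image_image[of "E q" b, symmetric])
    have "inj_on (\<lambda>i. E q (b i)) {..<card B}"
      using comp_inj_on[OF bij_betw_imp_inj_on[OF b] inj_on_subset[OF inj subset_UNIV]] by (simp add: comp_def)
    moreover have "independent (E q ` B)"
      by (rule linear_independent_injective_image[OF lin independent_B inj_on_subset[OF inj subset_UNIV]])
    moreover have "span (E q ` B) = sharp_graph A \<omega> q"
      unfolding linear_span_image[OF lin] span_B sharp_graph_eq_range[OF c(1) q] by (simp only: E_def[abs_def])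
    ultimately show ?thesis by (simp add: img)
  qed
  show "\<exists>U r (s :: nat \<Rightarrow> 'm \<Rightarrow> ('m, 'e) gvec). open U \<and> p \<in> U \<and> (\<forall>i<r. smooth_section_on A n U (s i)) \<and>
      (\<forall>q\<in>U. inj_on (\<lambda>i. s i q) {..<r} \<and> independent ((\<lambda>i. s i q) ` {..<r}) \<and>
        span ((\<lambda>i. s i q) ` {..<r}) = sharp_graph A \<omega> q)"
    using smooth_frame frame open_dom[OF c(1)] c(2)
    by (intro exI[of _ "dom_of c"] exI[of _ "card B"] exI[of _ "\<lambda>i q. E q (b i)"]) blast
qed

text \<open>The two terms of the pairing differ by exchanging the first two arguments of
  \<open>\<omega>\<close>, so they cancel.\<close>

lemma isotropic_graph:
  assumes \<omega>: "smooth_form_on A (Suc n) UNIV \<omega>"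
  shows "isotropic_subbundle A n (sharp_graph A \<omega>)"
  unfolding isotropic_subbundle_def
proof (intro conjI allI ballI)
  fix p \<xi> \<zeta> assume "\<xi> \<in> sharp_graph A \<omega> p" "\<zeta> \<in> sharp_graph A \<omega> p"
  then obtain X Y where "\<xi> = (X, contract X (\<omega> p))" "\<zeta> = (Y, contract Y (\<omega> p))"
    unfolding sharp_graph_def by blast
  moreover have "\<omega> p (Y # X # vs) = - \<omega> p (X # Y # vs)" for vs
    using alt_swap[OF smooth_form_alt[OF \<omega> UNIV_I], of p "[]" Y X vs] by simp
  ultimately show "pairing \<xi> \<zeta> = 0"
    by (simp add: pairing_def contract_def fun_eq_iff scaleR_fun_def)
qed (rule smooth_subbundle_graph[OF \<omega>])

lemma maximal_isotropic_graph:
  assumes \<omega>: "smooth_form_on A (Suc n) UNIV \<omega>" and n: "n \<ge> 1"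
  shows "maximal_isotropic_subbundle A n (sharp_graph A \<omega>)"
proof -
  have "H p \<subseteq> sharp_graph A \<omega> p"
    if H: "isotropic_subbundle A n H" and le: "\<And>p. sharp_graph A \<omega> p \<subseteq> H p" for H p
  proof
    fix \<xi> assume \<xi>: "\<xi> \<in> H p"
    obtain Y \<beta> where Y\<beta>: "\<xi> = (Y, \<beta>)" by (cases \<xi>)
    have sub: "subspace (H p)" "H p \<subseteq> tangent_space A p \<times> alt_forms A n p"
      using H unfolding isotropic_subbundle_def smooth_subbundle_def by blast+
    have Y: "Y \<in> tangent_space A p" using sub(2) \<xi> Y\<beta> by blast
    define \<gamma> where "\<gamma> = \<beta> - contract Y (\<omega> p)"
    have "(Y, contract Y (\<omega> p)) \<in> H p" using Y le unfolding sharp_graph_def by blast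
    \<comment> \<open>Subtracting the point of the graph with the same vector part leaves a pure
      form, which still pairs to 0 with the graph.\<close>
    from subspace_diff[OF sub(1) \<xi> this] have \<gamma>: "(0, \<gamma>) \<in> H p" by (simp add: Y\<beta> \<gamma>_def)
    then have \<gamma>_alt: "\<gamma> \<in> alt_forms A n p" using sub(2) by blast
    have \<gamma>_X: "\<gamma> (X # vs) = 0" if X: "X \<in> tangent_space A p" for X vs
    proof -
      have "(X, contract X (\<omega> p)) \<in> H p" using X le unfolding sharp_graph_def by blast
      with \<gamma> H have "pairing (X, contract X (\<omega> p)) (0, \<gamma>) = 0"
        unfolding isotropic_subbundle_def by blast
      from fun_cong[OF this, of vs] have "\<gamma> (X # vs) + \<omega> p (X # 0 # vs) = 0"
        by (simp add: pairing_def contract_def scaleR_fun_def)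
      moreover have "\<omega> p (X # 0 # vs) = 0"
        using alt_scale[OF smooth_form_alt[OF \<omega> UNIV_I] X, of "[X]" 0 vs] by simp
      ultimately show ?thesis by simp
    qed
    have "\<gamma> vs = 0" for vs
    \<comment> \<open>If \<open>vs\<close> is empty, its length differs from \<open>n\<close>
      because \<open>n \<ge> 1\<close>; if its head is not tangent, normalisation gives 0.\<close>
    proof (cases "\<exists>X ws. vs = X # ws \<and> X \<in> tangent_space A p")
      case True
      then show ?thesis using \<gamma>_X by blast
    next
      case False
      then show ?thesis using n by (cases vs) (auto intro!: alt_outside[OF \<gamma>_alt])
    qed
    then have "\<beta> = contract Y (\<omega> p)" by (simp add: \<gamma>_def fun_eq_iff)
    then show "\<xi> \<in> sharp_graph A \<omega> p" using Y Y\<beta> unfolding sharp_graph_def by blast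
  qed
  then have "H = sharp_graph A \<omega>"
    if "isotropic_subbundle A n H" "\<forall>p. sharp_graph A \<omega> p \<subseteq> H p" for H
    using that by (intro ext equalityI) blast+
  then show ?thesis
    using isotropic_graph[OF \<omega>] unfolding maximal_isotropic_subbundle_def by blast
qed

end

theorem theorem4p2:
  fixes A :: "('m::{t2_space, second_countable_topology}, 'e::real_inner) chart set"
    and n :: nat
    and \<omega> :: "'m \<Rightarrow> ('m, 'e) cov"
  assumes "smooth_manifold A"
    and "n \<ge> 1"
    and "smooth_form_on A (n + 1) UNIV \<omega>"
  shows "maximal_isotropic_subbundle A n (sharp_graph A \<omega>) \<and>
    (closed_under_dorfman A n (sharp_graph A \<omega>) \<longleftrightarrow> closed_form A \<omega>)"
proof -
  \<comment> \<open>The definition of a manifold provides only a finite spanning set, which is then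
    orthonormalised.\<close>
  obtain B0 :: "'e set" where "finite B0" "span B0 = UNIV"
    using assms(1) unfolding smooth_manifold_def by blast
  then obtain B :: "'e set" where B: "orthonormal_basis B"
    using orthonormal_basis_exists by blast
  interpret manifold B A
    by (rule manifold.intro[OF B]) (rule manifold_axioms.intro[OF assms(1)])
  have "smooth_form_on A (Suc n) UNIV \<omega>" using assms(3) by simp
  with assms(2) show ?thesis
    using maximal_isotropic_graph closed_under_dorfman_graph_iff by blast
qed

end
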